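(* Let $s,t\ge 3$ be integers with $\min\{s,t\}\le 6$. Then $$\operatorname{gp}(C_s\boxtimes C_t)=\begin{cases}4, & s=t=4,\\ 6, & \text{exactly one of }s,t\text{ equals }4,\\ 9, & 4\notin\{s,t\}.\end{cases}$$
   Context: All graphs are finite, simple and connected. $d_G(u,v)$ is the usual shortest-path distance in $G$. A set $S\subseteq V(G)$ is a general position set of $G$ if no vertex of $S$ lies on a shortest path between two other vertices of $S$; equivalently, $d_G(u,v)\ne d_G(u,w)+d_G(w,v)$ for all pairwise distinct $u,v,w\in S$. The general position number $\operatorname{gp}(G)$ is the maximum cardinality of a general position set of $G$. The strong product $G\boxtimes H$ has vertex set $V(G)\times V(H)$; distinct vertices $(u_x,u_y)$ and $(v_x,v_y)$ are adjacent if and only if ($u_x=v_x$ and $u_yv_y\in E(H)$), or ($u_y=v_y$ and $u_xv_x\in E(G)$), or ($u_xv_x\in E(G)$ and $u_yv_y\in E(H)$). $C_n$ is the cycle on $n$ vertices. *)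

theory Defs
  imports "Graph_Theory.Pair_Digraph" "Graph_Theory.Shortest_Path"
begin

text \<open>
  A finite simple graph is a \<open>pair_graph\<close>: a finite, loop-free, symmetric digraph without
  parallel arcs, each edge being represented by its two opposite arcs.
\<close>

definition cycle_graph :: "nat \<Rightarrow> nat pair_pre_digraph" where
  "cycle_graph n = \<lparr> pverts = {..<n},
     parcs = {(i, j). i < n \<and> j < n \<and> (j = Suc i mod n \<or> i = Suc j mod n)} \<rparr>"

definition strong_product ::
    "'a pair_pre_digraph \<Rightarrow> 'b pair_pre_digraph \<Rightarrow> ('a \<times> 'b) pair_pre_digraph"
    (infixl "\<boxtimes>" 70) where
  "G \<boxtimes> H = \<lparr> pverts = pverts G \<times> pverts H,
     parcs = {((ux, uy), (vx, vy)).
        (ux \<in> pverts G \<and> ux = vx \<and> (uy, vy) \<in> parcs H)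
      \<or> (uy \<in> pverts H \<and> uy = vy \<and> (ux, vx) \<in> parcs G)
      \<or> ((ux, vx) \<in> parcs G \<and> (uy, vy) \<in> parcs H)} \<rparr>"

text \<open>
  With unit weights the cost of a walk is its length, so \<open>\<mu>\<close> is the hop distance;
  it is extended real valued, with \<open>\<infinity>\<close> between different components.
\<close>

definition graph_dist :: "'a pair_pre_digraph \<Rightarrow> 'a \<Rightarrow> 'a \<Rightarrow> ereal" where
  "graph_dist G u v = wf_digraph.\<mu> (with_proj G) (\<lambda>_. 1) u v"

definition general_position_set :: "'a pair_pre_digraph \<Rightarrow> 'a set \<Rightarrow> bool" where
  "general_position_set G S \<longleftrightarrow> S \<subseteq> pverts G \<and>
     (\<forall>u \<in> S. \<forall>v \<in> S. \<forall>w \<in> S. u \<noteq> v \<longrightarrow> u \<noteq> w \<longrightarrow> v \<noteq> w \<longrightarrow>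
        graph_dist G u v \<noteq> graph_dist G u w + graph_dist G w v)"

definition gp :: "'a pair_pre_digraph \<Rightarrow> nat" where
  "gp G = Max (card ` {S. general_position_set G S})"

lemma pair_graph_cycle_graph:
  assumes "n \<ge> 3"
  shows "pair_graph (cycle_graph n)"
proof
  fix e assume e: "e \<in> parcs (cycle_graph n)"
  show "fst e \<in> pverts (cycle_graph n)" "snd e \<in> pverts (cycle_graph n)"
    using e by (auto simp: cycle_graph_def)
  show "fst e \<noteq> snd e"
    using e assms by (auto simp: cycle_graph_def mod_Suc split: if_splits)
next
  have "parcs (cycle_graph n) \<subseteq> {..<n} \<times> {..<n}"
    by (auto simp: cycle_graph_def)
  then show "finite (parcs (cycle_graph n))"
    by (rule finite_subset) simp
qed (auto simp: cycle_graph_def symmetric_def sym_def)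

lemma pair_graph_strong_product:
  assumes "pair_graph G" "pair_graph H"
  shows "pair_graph (G \<boxtimes> H)"
proof -
  interpret G: pair_graph G by fact
  interpret H: pair_graph H by fact
  have arcs: "parcs (G \<boxtimes> H) \<subseteq> (pverts G \<times> pverts H) \<times> (pverts G \<times> pverts H)"
    by (auto simp: strong_product_def dest: G.wellformed' H.wellformed')
  show ?thesis
  proof
    fix e assume e: "e \<in> parcs (G \<boxtimes> H)"
    show "fst e \<in> pverts (G \<boxtimes> H)" "snd e \<in> pverts (G \<boxtimes> H)"
      using e by (auto simp: strong_product_def dest: G.wellformed' H.wellformed')
    show "fst e \<noteq> snd e"
      using e by (auto simp: strong_product_def dest: G.pair_no_loops H.pair_no_loops)
  next
    show "finite (pverts (G \<boxtimes> H))"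
      by (simp add: strong_product_def G.pair_finite_verts H.pair_finite_verts)
    show "finite (parcs (G \<boxtimes> H))"
      using arcs by (rule finite_subset) (simp add: G.pair_finite_verts H.pair_finite_verts)
    have "sym (parcs G)" "sym (parcs H)"
      using G.pair_sym_arcs H.pair_sym_arcs by (auto simp: symmetric_def)
    then show "symmetric (with_proj (G \<boxtimes> H))"
      by (auto simp: symmetric_def strong_product_def sym_def)
  qed
qed

end

theory Submission
  imports Defs
begin

text \<open>
  The distance in $C_s \boxtimes C_t$ is the larger of the two cyclic distances of the coordinates
  (\<open>graph_dist_cycles\<close>). Hence a vertex lies between two others exactly when it does so in a
  coordinate that realises all three distances, and the product of general position sets of the factors is a
  general position set (\<open>between_free_Times\<close>). With two neighbours in $C_4$ and the three
  vertices $0, k, 2k$ with $k = \lfloor (n-1)/2 \rfloor$ in any other cycle, this gives the lower bounds.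

  For the upper bound let $s$ be four if that is one of the two lengths and the smaller length otherwise, so
  that $s \in \{3,4,5,6\}$; let $t$ be the other length, and let $w = 2$ if $s = 4$ and $w = 3$ otherwise.
  Leave $s = t = 4$ aside. It has to be shown that $3w+1$ points in general position are impossible. Unroll
  the second cycle: the points become a set $P \subseteq C_s \times \int$ that is periodic with period $t$.
  Write $u \prec v$ if $v$ is above $u$ by at least the cyclic distance of their columns. This is a partial
  order, and with $h = \lfloor t/2 \rfloor$ general position says:

  \<^item> a chain $u \prec v \prec r$ rises by more than $h$ levels, since otherwise $v$ is between $u$ and
    $r$;

  \<^item> the columns of an antichain are distinct and in general position in $C_s$, so an antichain has at
    most $w$ points. Because $s \le 6$, an antichain of the maximal size $w$ occupies at most two neighbouring
    levels.

  Take an antichain $A$ of size $w$; without one, a period would have at most $4(w-1)$ points. A period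
  contains $2w+1$ further points, which lie strictly between $A$ and its translate $A+t$. Those that are
  minimal or maximal there form two antichains, so they are at most $2w$ in number, and some chain $a \prec b
  \prec r \prec c \prec a'+t$ exists (\<open>middle_chain\<close>). Its two halves rise by more than $h$
  levels each, which forces $a'$ to be at least $2h+2-t$ levels above $a$. So $t$ is odd and every antichain
  of size $w$ straddles two neighbouring levels (\<open>staggered_middle_chain\<close>).

  As $w \le 3$, one of these levels carries a single point of $A$, and the same chain shows that this point
  can be exchanged for one on the far side of the other points of $A$ (\<open>one_lower_raise\<close>,
  \<open>one_upper_lower\<close>). Counting between two such antichains determines the levels of all points of
  a period: they come in two clusters, half a period apart (\<open>one_lower_structure\<close>). Applied to an
  antichain of the opposite cluster the same statement asks for points on levels that are empty if $h \ge 4$,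
  and for three points of one column that are too close to each other if $h = 3$. If $h = 1$, each of the
  three levels carries at most $w$ points. What is left is $h = 2$, that is, $t = 5$, where the structure
  leaves only $s = 5$, and this case is excluded by inspection (\<open>card_neq\<close>). Finally $C_4
  \boxtimes C_4$, where five points have to be excluded, is treated by a direct argument about antipodes
  (\<open>card_neq_4_4\<close>).
\<close>

section \<open>Distances in the strong product of two cycles\<close>

text \<open>
  The distance from \<open>u\<close> is characterised locally: it vanishes only at \<open>u\<close>, grows by
  at most one along an arc, and every other vertex has an in-neighbour on which it is smaller by one.
\<close>

lemma graph_dist_eqI:
  fixes f :: "'a \<Rightarrow> nat"
  assumes G: "pair_wf_digraph G" and u: "u \<in> pverts G"
    and zero: "\<And>v. v \<in> pverts G \<Longrightarrow> f v = 0 \<longleftrightarrow> v = u"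
    and arc: "\<And>v w. (v, w) \<in> parcs G \<Longrightarrow> f w \<le> Suc (f v)"
    and descend: "\<And>v. v \<in> pverts G \<Longrightarrow> f v > 0 \<Longrightarrow> \<exists>w. (w, v) \<in> parcs G \<and> f w = f v - 1"
    and v: "v \<in> pverts G"
  shows "graph_dist G u v = ereal (f v)"
proof -
  interpret pair_wf_digraph G by fact
  have cost: "awalk_cost (\<lambda>_. 1) p = real (length p)" for p :: "('a \<times> 'a) list"
    by (induction p) auto
  have lower: "f x \<le> f w + length p" if "awalk w p x" for w p x
    using that
  proof (induction p arbitrary: w)
    case Nil
    then show ?case by (simp add: awalk_Nil_iff)
  next
    case (Cons e p)
    then have "e \<in> parcs G" "w = fst e" "awalk (snd e) p x"
      by (auto simp: awalk_Cons_iff)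
    then show ?case
      using Cons.IH[of "snd e"] arc[of "fst e" "snd e"] by simp
  qed
  have walk: "\<exists>p. awalk u p w \<and> length p = n" if "w \<in> pverts G" "f w = n" for w n
    using that
  proof (induction n arbitrary: w)
    case 0
    then have "w = u" using zero by simp
    then have "awalk u [] w" using u by (simp add: awalk_Nil_iff)
    then show ?case by auto
  next
    case (Suc n)
    then obtain x where x: "(x, w) \<in> parcs G" "f x = n"
      using descend[of w] by auto
    then obtain p where "awalk u p x" "length p = n"
      using Suc.IH[of x] in_arcsD1 by blast
    moreover have "awalk x [(x, w)] w"
      using x(1) by (auto simp: awalk_Cons_iff awalk_Nil_iff dest: in_arcsD1 in_arcsD2)
    ultimately have "awalk u (p @ [(x, w)]) w" "length (p @ [(x, w)]) = Suc n"
      by auto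
    then show ?case by blast
  qed
  obtain p where p: "awalk u p v" "length p = f v" using walk[OF v refl] by blast
  show ?thesis
    unfolding graph_dist_def \<mu>_def
  proof (rule INF_eqI)
    fix q assume "q \<in> {q. awalk u q v}"
    then have "f v \<le> f u + length q" using lower by blast
    then show "ereal (real (f v)) \<le> ereal (awalk_cost (\<lambda>_. 1) q)"
      using zero[OF u] by (simp add: cost)
  next
    fix z assume "\<And>q. q \<in> {q. awalk u q v} \<Longrightarrow> z \<le> ereal (awalk_cost (\<lambda>_. 1) q)"
    then show "z \<le> ereal (real (f v))" using p by (metis cost mem_Collect_eq)
  qed
qed

text \<open>
  The coordinates are arbitrary integers, read modulo \<open>n\<close>, so that the same function also
  measures distances between levels of the unrolled cycle.
\<close>

definition cyc_dist :: "nat \<Rightarrow> int \<Rightarrow> int \<Rightarrow> int" where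
  "cyc_dist n i j = min ((i - j) mod int n) ((j - i) mod int n)"

text \<open>
  Together with the next lemma: the cyclic distance is the least absolute value in the residue class of the
  difference. All metric properties follow from this description.
\<close>

lemma cyc_dist_le: "n > 0 \<Longrightarrow> cyc_dist n i j \<le> \<bar>i - j + k * int n\<bar>"
proof -
  assume n: "n > 0"
  define a where "a = i - j + k * int n"
  have "(i - j) mod int n = a mod int n" by (simp add: a_def)
  moreover have "(j - i) mod int n = (- a) mod int n"
  proof -
    have "- a = (j - i) + (- k) * int n" by (simp add: a_def)
    then show ?thesis by (metis mod_mult_self1)
  qed
  moreover have "b mod int n \<le> b" if "b \<ge> 0" for b using that n by (simp add: zmod_le_nonneg_dividend)
  ultimately show ?thesis unfolding cyc_dist_def a_def[symmetric]
    by (metis abs_minus_cancel abs_of_nonneg linear min.coboundedI1 min.coboundedI2 neg_0_le_iff_le)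
qed

lemma cyc_dist_attained: "n > 0 \<Longrightarrow> \<exists>k. cyc_dist n i j = \<bar>i - j + k * int n\<bar>"
proof -
  assume n: "n > 0"
  have "(i - j) mod int n = i - j + (- ((i - j) div int n)) * int n"
    "(j - i) mod int n = - (i - j + ((j - i) div int n) * int n)"
    by (simp_all add: minus_div_mult_eq_mod[symmetric] algebra_simps)
  moreover have "(i - j) mod int n \<ge> 0" "(j - i) mod int n \<ge> 0" using n by simp_all
  ultimately show ?thesis unfolding cyc_dist_def min_def
    by (metis abs_of_nonneg abs_minus_cancel)
qed

lemma cyc_dist_self [simp]: "cyc_dist n i i = 0"
  by (simp add: cyc_dist_def)

lemma cyc_dist_sym: "cyc_dist n i j = cyc_dist n j i"
  by (simp add: cyc_dist_def min.commute)

lemma cyc_dist_nonneg: "n > 0 \<Longrightarrow> 0 \<le> cyc_dist n i j"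
  by (simp add: cyc_dist_def)

lemma cyc_dist_triangle:
  assumes "n > 0" shows "cyc_dist n i k \<le> cyc_dist n i j + cyc_dist n j k"
proof -
  obtain a b where ab: "cyc_dist n i j = \<bar>i - j + a * int n\<bar>" "cyc_dist n j k = \<bar>j - k + b * int n\<bar>"
    using cyc_dist_attained[OF assms] by metis
  have "cyc_dist n i k \<le> \<bar>i - k + (a + b) * int n\<bar>" by (rule cyc_dist_le[OF assms])
  also have "i - k + (a + b) * int n = (i - j + a * int n) + (j - k + b * int n)"
    by (simp add: algebra_simps)
  finally show ?thesis using ab by linarith
qed

lemma cyc_dist_mod [simp]:
  "cyc_dist n (i mod int n) j = cyc_dist n i j" "cyc_dist n i (j mod int n) = cyc_dist n i j"
  by (simp_all add: cyc_dist_def mod_simps)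

lemma cyc_dist_le_abs: "n > 0 \<Longrightarrow> cyc_dist n i j \<le> \<bar>i - j\<bar>"
  using cyc_dist_le[of n i j 0] by simp

text \<open>
  Unrolling the cycle does not change distances up to half the period.
\<close>

lemma cyc_dist_close:
  assumes "2 * \<bar>i - j\<bar> \<le> int n" shows "cyc_dist n i j = \<bar>i - j\<bar>"
proof (cases "n = 0")
  case False
  then have n: "n > 0" by simp
  obtain k where k: "cyc_dist n i j = \<bar>i - j + k * int n\<bar>" using cyc_dist_attained[OF n] by blast
  show ?thesis
  proof (cases "k = 0")
    case False
    then have "\<bar>k * int n\<bar> \<ge> int n" using n by (simp add: abs_mult mult_le_cancel_right1)
    moreover have "\<bar>k * int n\<bar> \<le> \<bar>i - j + k * int n\<bar> + \<bar>i - j\<bar>"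
      by (metis abs_triangle_ineq4 add.commute add_diff_cancel_right')
    moreover have "d \<le> X" if "N \<le> K" "K \<le> X + d" "2 * d \<le> N" for d X K N :: int
      using that by linarith
    ultimately have "cyc_dist n i j \<ge> \<bar>i - j\<bar>" unfolding k using assms by blast
    then show ?thesis using cyc_dist_le_abs[OF n, of i j] by simp
  qed (use k in simp)
qed (use assms in \<open>simp add: cyc_dist_def\<close>)

lemma cyc_dist_eq_abs:
  assumes "\<bar>i - j\<bar> < int n"
  shows "cyc_dist n i j = min \<bar>i - j\<bar> (int n - \<bar>i - j\<bar>)"
proof (cases "i = j")
  case False
  have "x mod int n = x \<and> (- x) mod int n = int n - x" if "0 < x" "x < int n" for x
    using that by (simp add: zmod_zminus1_eq_if)
  from this[of "i - j"] this[of "j - i"] show ?thesis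
    using False assms by (auto simp: cyc_dist_def abs_if min.commute)
qed (use assms in \<open>simp add: cyc_dist_def\<close>)

lemma cyc_dist_eq_0: "i < n \<Longrightarrow> j < n \<Longrightarrow> cyc_dist n (int i) (int j) = 0 \<longleftrightarrow> i = j"
  by (subst cyc_dist_eq_abs) (auto simp: min_def)

lemma cycle_arc_iff:
  assumes "i < n" "j < n"
  shows "(i, j) \<in> parcs (cycle_graph n) \<longleftrightarrow>
    int j = (int i + 1) mod int n \<or> int i = (int j + 1) mod int n"
proof -
  have "j = Suc i mod n \<longleftrightarrow> int j = (int i + 1) mod int n" for i j
    by (metis of_nat_Suc of_nat_eq_iff of_nat_mod add.commute)
  then show ?thesis using assms by (auto simp: cycle_graph_def)
qed

lemma cycle_arc_dist:
  assumes "(i, j) \<in> parcs (cycle_graph n)"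
  shows "i < n" "j < n" "cyc_dist n (int i) (int j) \<le> 1"
proof -
  show ij: "i < n" "j < n" using assms by (auto simp: cycle_graph_def)
  have "cyc_dist n (int i) (int i + 1) \<le> 1" "cyc_dist n (int j) (int j + 1) \<le> 1"
    using cyc_dist_le_abs[of n "int i" "int i + 1"] cyc_dist_le_abs[of n "int j" "int j + 1"] ij by auto
  then show "cyc_dist n (int i) (int j) \<le> 1"
    using assms ij by (auto simp: cycle_arc_iff cyc_dist_sym)
qed

lemma cycle_arc_descend:
  assumes ij: "i < n" "j < n" and pos: "cyc_dist n (int i) (int j) > 0"
  shows "\<exists>k. (k, j) \<in> parcs (cycle_graph n) \<and> cyc_dist n (int i) (int k) = cyc_dist n (int i) (int j) - 1"
proof -
  have n: "n > 0" using ij by simp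
  obtain m where m: "cyc_dist n (int i) (int j) = \<bar>int i - int j + m * int n\<bar>"
    using cyc_dist_attained[OF n] by blast
  define e :: int where "e = (if int i - int j + m * int n > 0 then 1 else - 1)"
  define k where "k = nat ((int j + e) mod int n)"
  have k: "int k = (int j + e) mod int n" "k < n" using n by (simp_all add: k_def nat_less_iff)
  have arc: "(k, j) \<in> parcs (cycle_graph n)"
    using k ij by (auto simp: cycle_arc_iff e_def mod_simps)
  have "cyc_dist n (int i) (int k) = cyc_dist n (int i) (int j + e)" by (simp add: k)
  also have "\<dots> \<le> \<bar>int i - (int j + e) + m * int n\<bar>" by (rule cyc_dist_le[OF n])
  also have "\<dots> = cyc_dist n (int i) (int j) - 1" using m pos by (auto simp: e_def)
  finally have "cyc_dist n (int i) (int k) \<le> cyc_dist n (int i) (int j) - 1" .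
  moreover have "cyc_dist n (int i) (int j) \<le> cyc_dist n (int i) (int k) + 1"
    using cyc_dist_triangle[OF n, of "int i" "int j" "int k"] cycle_arc_dist(3)[OF arc] by simp
  ultimately show ?thesis using arc by fastforce
qed

definition torus_dist :: "nat \<Rightarrow> nat \<Rightarrow> nat \<times> nat \<Rightarrow> nat \<times> nat \<Rightarrow> int" where
  "torus_dist s t u v = max (cyc_dist s (int (fst u)) (int (fst v))) (cyc_dist t (int (snd u)) (int (snd v)))"

lemma pverts_cycles: "pverts (cycle_graph s \<boxtimes> cycle_graph t) = {..<s} \<times> {..<t}"
  by (simp add: strong_product_def cycle_graph_def)

lemma graph_dist_cycles:
  assumes st: "s \<ge> 3" "t \<ge> 3" and u: "u \<in> {..<s} \<times> {..<t}" and v: "v \<in> {..<s} \<times> {..<t}"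
  shows "graph_dist (cycle_graph s \<boxtimes> cycle_graph t) u v = ereal (real_of_int (torus_dist s t u v))"
proof -
  let ?G = "cycle_graph s \<boxtimes> cycle_graph t"
  have pos: "s > 0" "t > 0" using st by auto
  have nonneg: "torus_dist s t u w \<ge> 0" for w
    using cyc_dist_nonneg[OF pos(1)] by (simp add: torus_dist_def le_max_iff_disj)
  have "pair_graph ?G"
    by (intro pair_graph_strong_product pair_graph_cycle_graph st)
  then interpret G: pair_graph ?G .
  obtain a b where ab: "u = (a, b)" "a < s" "b < t" using u by auto
  have "graph_dist ?G u v = ereal (real (nat (torus_dist s t u v)))"
  proof (rule graph_dist_eqI)
    show "pair_wf_digraph ?G" by unfold_locales
    show "u \<in> pverts ?G" "v \<in> pverts ?G" using u v by (simp_all add: pverts_cycles)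
  next
    fix w assume "w \<in> pverts ?G"
    then obtain x y where w: "w = (x, y)" "x < s" "y < t" by (auto simp: pverts_cycles)
    have "torus_dist s t u w \<le> 0 \<longleftrightarrow> cyc_dist s (int a) (int x) = 0 \<and> cyc_dist t (int b) (int y) = 0"
      using cyc_dist_nonneg[OF pos(1), of "int a" "int x"] cyc_dist_nonneg[OF pos(2), of "int b" "int y"]
      by (auto simp: torus_dist_def ab w)
    then show "nat (torus_dist s t u w) = 0 \<longleftrightarrow> w = u"
      using ab w by (auto simp: cyc_dist_eq_0)
    assume "nat (torus_dist s t u w) > 0"
    \<comment> \<open>A shortest path moves in every coordinate that has not yet reached its target; the others rest.\<close>
    have desc: "\<exists>k. k < n \<and> (k = j \<or> (k, j) \<in> parcs (cycle_graph n)) \<and>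
       cyc_dist n (int i) (int k) = max 0 (cyc_dist n (int i) (int j) - 1) \<and>
       (k = j \<longrightarrow> cyc_dist n (int i) (int j) = 0)" if "i < n" "j < n" for n i j
    proof (cases "cyc_dist n (int i) (int j) = 0")
      case False
      then have gt: "cyc_dist n (int i) (int j) > 0"
        using cyc_dist_nonneg[of n "int i" "int j"] that by simp
      from cycle_arc_descend[OF that gt] obtain k where
        k: "(k, j) \<in> parcs (cycle_graph n)" "cyc_dist n (int i) (int k) = cyc_dist n (int i) (int j) - 1"
        by blast
      then show ?thesis using gt cycle_arc_dist(1)[OF k(1)] by (intro exI[of _ k]) auto
    qed (use that in auto)
    obtain x' where x': "x' < s" "x' = x \<or> (x', x) \<in> parcs (cycle_graph s)"
      "cyc_dist s (int a) (int x') = max 0 (cyc_dist s (int a) (int x) - 1)"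
      "x' = x \<longrightarrow> cyc_dist s (int a) (int x) = 0"
      using desc[OF ab(2) w(2)] by blast
    obtain y' where y': "y' < t" "y' = y \<or> (y', y) \<in> parcs (cycle_graph t)"
      "cyc_dist t (int b) (int y') = max 0 (cyc_dist t (int b) (int y) - 1)"
      "y' = y \<longrightarrow> cyc_dist t (int b) (int y) = 0"
      using desc[OF ab(3) w(3)] by blast
    have ne: "(x', y') \<noteq> (x, y)"
      using x'(4) y'(4) \<open>nat (torus_dist s t u w) > 0\<close> by (auto simp: torus_dist_def ab w)
    then have "((x', y'), w) \<in> parcs ?G"
      using x' y' w by (auto simp: strong_product_def cycle_graph_def)
    moreover have "torus_dist s t u (x', y') = torus_dist s t u w - 1"
      using x'(3) y'(3) \<open>nat (torus_dist s t u w) > 0\<close> by (simp add: torus_dist_def ab w)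
    ultimately show "\<exists>w'. (w', w) \<in> parcs ?G \<and> nat (torus_dist s t u w') = nat (torus_dist s t u w) - 1"
      by (intro exI[of _ "(x', y')"]) auto
  next
    fix w z assume arc: "(w, z) \<in> parcs ?G"
    then have "w \<in> pverts ?G" "z \<in> pverts ?G" using G.wellformed' by auto
    then obtain x y x' y' where wz: "w = (x, y)" "z = (x', y')" "x < s" "x' < s" "y < t" "y' < t"
      by (auto simp: pverts_cycles)
    have "cyc_dist n i i = 0" for n i by (simp add: cyc_dist_def)
    then have "cyc_dist s (int x) (int x') \<le> 1" "cyc_dist t (int y) (int y') \<le> 1"
      using arc cycle_arc_dist(3) by (auto simp: strong_product_def wz)
    then have "torus_dist s t u z \<le> torus_dist s t u w + 1"
      using cyc_dist_triangle[OF pos(1), of "int a" "int x'" "int x"]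
        cyc_dist_triangle[OF pos(2), of "int b" "int y'" "int y"]
      by (auto simp: torus_dist_def wz ab)
    then show "nat (torus_dist s t u z) \<le> Suc (nat (torus_dist s t u w))" by linarith
  qed
  then show ?thesis using nonneg[of v] by simp
qed

definition between_free :: "('a \<Rightarrow> 'a \<Rightarrow> int) \<Rightarrow> 'a set \<Rightarrow> bool" where
  "between_free d S \<longleftrightarrow> (\<forall>u\<in>S. \<forall>v\<in>S. \<forall>w\<in>S. u \<noteq> v \<longrightarrow> u \<noteq> w \<longrightarrow> v \<noteq> w \<longrightarrow> d u v \<noteq> d u w + d w v)"

lemma general_position_set_cycles:
  assumes st: "s \<ge> 3" "t \<ge> 3"
  shows "general_position_set (cycle_graph s \<boxtimes> cycle_graph t) S \<longleftrightarrow>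
    S \<subseteq> {..<s} \<times> {..<t} \<and> between_free (torus_dist s t) S"
proof -
  have "graph_dist (cycle_graph s \<boxtimes> cycle_graph t) u v =
      graph_dist (cycle_graph s \<boxtimes> cycle_graph t) u w + graph_dist (cycle_graph s \<boxtimes> cycle_graph t) w v
    \<longleftrightarrow> torus_dist s t u v = torus_dist s t u w + torus_dist s t w v"
    if "u \<in> {..<s} \<times> {..<t}" "v \<in> {..<s} \<times> {..<t}" "w \<in> {..<s} \<times> {..<t}" for u v w
    using that by (simp add: graph_dist_cycles[OF st] flip: of_int_add)
  then show ?thesis
    unfolding general_position_set_def between_free_def pverts_cycles by (meson subsetD)
qed

section \<open>Periodic point sets of bounded width\<close>

text \<open>
  The order \<open>\<prec>\<close> of the introduction; \<open>d\<close> is the distance of the columns, the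
  second component is the level. The strict inequality makes the relation irreflexive, whatever
  \<open>d\<close> is.
\<close>

definition steep :: "('c \<Rightarrow> 'c \<Rightarrow> int) \<Rightarrow> 'c \<times> int \<Rightarrow> 'c \<times> int \<Rightarrow> bool" where
  "steep d u v \<longleftrightarrow> snd u < snd v \<and> d (fst u) (fst v) \<le> snd v - snd u"

definition flat_set :: "('c \<Rightarrow> 'c \<Rightarrow> int) \<Rightarrow> ('c \<times> int) set \<Rightarrow> ('c \<times> int) set \<Rightarrow> bool" where
  "flat_set d P Q \<longleftrightarrow> Q \<subseteq> P \<and> (\<forall>u\<in>Q. \<forall>v\<in>Q. \<not> steep d u v)"

text \<open>
  The combinatorial consequences of general position, freed from the cycles: \<open>h\<close> is half the
  period \<open>t\<close>, rounded down, and \<open>w\<close> bounds the size of antichains.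
\<close>

locale band =
  fixes P :: "('c \<times> int) set" and d :: "'c \<Rightarrow> 'c \<Rightarrow> int" and t h :: int and w :: nat
  assumes d_self: "d x x = 0"
    and d_triangle: "d x z \<le> d x y + d y z"
    and periodic: "(x, k) \<in> P \<Longrightarrow> (x, k + i * t) \<in> P"
    and period: "t = 2 * h \<or> t = 2 * h + 1" "h \<ge> 1"
    and long_chain: "\<lbrakk>u \<in> P; v \<in> P; r \<in> P; steep d u v; steep d v r\<rbrakk> \<Longrightarrow> h < snd r - snd u"
    and width: "flat_set d P Q \<Longrightarrow> finite Q \<and> card Q \<le> w"
begin

abbreviation prec (infix "\<prec>" 50) where "u \<prec> v \<equiv> steep d u v"
abbreviation antichain where "antichain Q \<equiv> flat_set d P Q"

definition shift :: "int \<Rightarrow> 'c \<times> int \<Rightarrow> 'c \<times> int" where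
  "shift m p = (fst p, snd p + m * t)"

definition Up :: "('c \<times> int) set \<Rightarrow> ('c \<times> int) set" where
  "Up A = {p \<in> P. \<exists>a\<in>A. a \<prec> p}"

definition Down :: "('c \<times> int) set \<Rightarrow> ('c \<times> int) set" where
  "Down A = {p \<in> P. \<exists>a\<in>A. p \<prec> a}"

lemma t_pos: "t \<ge> 2" using period by auto

lemma prec_trans: "u \<prec> v \<Longrightarrow> v \<prec> z \<Longrightarrow> u \<prec> z"
  using d_triangle[of "fst u" "fst z" "fst v"] by (auto simp: steep_def)

lemma prec_level: "u \<prec> v \<Longrightarrow> snd u < snd v"
  by (simp add: steep_def)

lemma prec_column: "fst u = fst v \<Longrightarrow> snd u < snd v \<Longrightarrow> u \<prec> v"
  by (simp add: steep_def d_self)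

lemma snd_shift [simp]: "snd (shift m p) = snd p + m * t"
  and fst_shift [simp]: "fst (shift m p) = fst p"
  by (simp_all add: shift_def)

lemma shift_in_P: "p \<in> P \<Longrightarrow> shift m p \<in> P"
  using periodic[of "fst p" "snd p" m] by (simp add: shift_def)

lemma shift_shift [simp]: "shift m (shift n p) = shift (m + n) p"
  by (simp add: shift_def algebra_simps)

lemma shift_0 [simp]: "shift 0 p = p"
  by (simp add: shift_def)

lemma inj_shift: "inj_on (shift m) Q"
  by (rule inj_onI) (simp add: shift_def prod_eq_iff)

lemma prec_shift [simp]: "shift m u \<prec> shift m v \<longleftrightarrow> u \<prec> v"
  by (simp add: steep_def)

lemma antichain_shift: "antichain A \<Longrightarrow> antichain (shift m ` A)"
  by (auto simp: flat_set_def shift_in_P)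

lemma card_shift: "card (shift m ` A) = card A"
  by (rule card_image[OF inj_shift])

lemma antichain_level:
  "Q \<subseteq> P \<Longrightarrow> (\<And>u. u \<in> Q \<Longrightarrow> snd u = y) \<Longrightarrow> antichain Q"
  by (auto simp: flat_set_def steep_def)

lemma multiple_cases: "m = 0 \<or> m * t \<ge> t \<or> m * t \<le> - t" for m :: int
proof -
  have "m * t \<ge> 1 * t" if "m \<ge> 1" using that t_pos by (intro mult_right_mono) auto
  moreover have "m * t \<le> (- 1) * t" if "m \<le> - 1" using that t_pos by (intro mult_right_mono) auto
  ultimately show ?thesis by force
qed

lemma Up_Down_disjoint:
  assumes "antichain A" "p \<in> Up A"
  shows "p \<notin> A" "p \<notin> Down A"
  using assms prec_trans unfolding flat_set_def Up_def Down_def by blast+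

lemma eventually_above: "\<exists>k. \<forall>m\<ge>k. a \<prec> shift m p"
proof -
  define k where "k = \<bar>snd a\<bar> + \<bar>snd p\<bar> + \<bar>d (fst a) (fst p)\<bar> + 1"
  have "a \<prec> shift m p" if "m \<ge> k" for m
  proof -
    have "k \<ge> 0" by (simp add: k_def)
    then have "k \<le> m * t" using that t_pos mult_mono[of k m 1 t] by simp
    then show ?thesis unfolding steep_def k_def by (simp; linarith)
  qed
  then show ?thesis by blast
qed

lemma eventually_below: "\<exists>k. \<forall>m\<le>k. shift m p \<prec> a"
proof -
  obtain k where k: "\<forall>m\<ge>k. p \<prec> shift m a" using eventually_above by blast
  have "shift m p \<prec> a" if "m \<le> - k" for m
    using k[rule_format, of "- m"] prec_shift[of m p "shift (- m) a"] that by simp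
  then show ?thesis by blast
qed

text \<open>
  A set that meets every orbit of the translation by \<open>t\<close> is at least as large as one period.
\<close>

lemma card_transversal:
  assumes "finite J" "\<And>p. p \<in> P \<Longrightarrow> \<exists>m. shift m p \<in> J"
  shows "card {p \<in> P. 0 \<le> snd p \<and> snd p < t} \<le> card J"
proof -
  have "{p \<in> P. 0 \<le> snd p \<and> snd p < t} \<subseteq> (\<lambda>p. (fst p, snd p mod t)) ` J"
  proof
    fix p assume p: "p \<in> {p \<in> P. 0 \<le> snd p \<and> snd p < t}"
    then obtain m where "shift m p \<in> J" using assms(2) by blast
    moreover have "p = (fst (shift m p), snd (shift m p) mod t)" using p by (simp add: prod_eq_iff)
    ultimately show "p \<in> (\<lambda>p. (fst p, snd p mod t)) ` J" by blast
  qed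
  then show ?thesis by (rule surj_card_le[OF assms(1)])
qed

lemma minimal_antichain: "Q \<subseteq> P \<Longrightarrow> antichain {p \<in> Q. \<forall>q\<in>Q. \<not> q \<prec> p}"
  and maximal_antichain: "Q \<subseteq> P \<Longrightarrow> antichain {p \<in> Q. \<forall>q\<in>Q. \<not> p \<prec> q}"
  by (auto simp: flat_set_def)

text \<open>
  Within \<open>h + 1\<close> consecutive levels no chain has three points, so the minimal points and the
  others are two antichains.
\<close>

lemma window_card:
  assumes Q: "Q \<subseteq> P" "\<And>q. q \<in> Q \<Longrightarrow> y \<le> snd q \<and> snd q \<le> y + h"
    and k: "\<And>A. antichain A \<Longrightarrow> card A \<le> k"
  shows "finite Q \<and> card Q \<le> 2 * k"
proof -
  define B where "B = {p \<in> Q. \<forall>q\<in>Q. \<not> q \<prec> p}"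
  have B: "antichain B" unfolding B_def by (rule minimal_antichain[OF Q(1)])
  have "\<not> u \<prec> v" if "u \<in> Q - B" "v \<in> Q" for u v
  proof
    assume uv: "u \<prec> v"
    obtain q where "q \<in> Q" "q \<prec> u" using \<open>u \<in> Q - B\<close> by (auto simp: B_def)
    then have "h < snd v - snd q" using long_chain uv that Q(1) by blast
    then show False using Q(2)[of v] Q(2)[of q] \<open>q \<in> Q\<close> that by auto
  qed
  then have "antichain (Q - B)" using Q(1) by (auto simp: flat_set_def)
  moreover have "Q = B \<union> (Q - B)" by (auto simp: B_def)
  ultimately have "finite B" "finite (Q - B)" "card B \<le> k" "card (Q - B) \<le> k" "Q = B \<union> (Q - B)"
    using B width k by blast+
  then show ?thesis using card_Un_le[of B "Q - B"] by (metis finite_UnI add_mono le_trans mult_2)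
qed

end

text \<open>
  One point more than \<open>3 * w\<close> in a period. The assumption \<open>span\<close> holds for the
  product only because the first cycle is short; \<open>column\<close> says that the exchange of a single
  point of a largest antichain across the level of the others keeps its column.
\<close>

locale crowded_band = band P d t h w
  for P :: "('c \<times> int) set" and d :: "'c \<Rightarrow> 'c \<Rightarrow> int" and t h :: int and w :: nat +
  assumes span: "\<lbrakk>flat_set d P Q; card Q = w; u \<in> Q; v \<in> Q\<rbrakk> \<Longrightarrow> snd u \<le> snd v + 1"
    and column: "\<lbrakk>flat_set d P (insert a M); card (insert a M) = w; a \<notin> M;
        flat_set d P (insert b M); card (insert b M) = w; b \<notin> M;
        \<And>m. m \<in> M \<Longrightarrow> snd m = snd a + 1; snd b = snd a + 2\<rbrakk> \<Longrightarrow> fst a = fst b"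
    and w: "w = 2 \<or> w = 3"
    and crowded: "card {p \<in> P. 0 \<le> snd p \<and> snd p < t} = 3 * w + 1"
begin

lemma trichotomy:
  assumes A: "antichain A" "card A = w" and p: "p \<in> P"
  shows "p \<in> A \<or> p \<in> Up A \<or> p \<in> Down A"
proof (rule ccontr)
  assume neg: "\<not> ?thesis"
  have "antichain (insert p A)"
    using neg A(1) p by (auto simp: flat_set_def Up_def Down_def steep_def)
  then have "card (insert p A) \<le> w" using width by blast
  moreover have "finite A" "p \<notin> A" using width A(1) neg by auto
  ultimately show False using A(2) by simp
qed

text \<open>
  Translating a point upwards, it eventually passes from below \<open>A\<close> to \<open>A\<close> or above;
  at the first such position it is still below the translate of \<open>A\<close>.
\<close>

lemma fundamental_domain:
  assumes A: "antichain A" "card A = w" and p: "p \<in> P"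
  shows "\<exists>m. shift m p \<in> (A \<union> Up A) \<inter> Down (shift 1 ` A)"
proof -
  have "A \<noteq> {}" using A(2) w by auto
  then obtain a where a: "a \<in> A" by blast
  obtain k1 where k1: "shift k1 p \<prec> a" using eventually_below by blast
  obtain k2 where k2: "\<And>m. m \<ge> k2 \<Longrightarrow> a \<prec> shift m p" using eventually_above by blast
  define above where "above n \<longleftrightarrow> shift (k1 + int n) p \<in> A \<union> Up A" for n
  have "shift k1 p \<in> Down A" using k1 a p by (auto simp: Down_def shift_in_P)
  moreover have "shift k1 p \<notin> A" using A(1) a k1 by (auto simp: flat_set_def)
  ultimately have "\<not> above 0"
    using Up_Down_disjoint(2)[OF A(1)] unfolding above_def by (simp; blast)
  moreover have "a \<prec> shift (k1 + int (nat (k2 - k1))) p" by (rule k2) simp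
  then have "above (nat (k2 - k1))"
    unfolding above_def Up_def using a p shift_in_P by blast
  ultimately obtain n where n: "\<not> above n" "above (Suc n)"
    using ex_least_nat_less[of above "nat (k2 - k1)"] by blast
  have "shift (k1 + int n) p \<in> Down A"
    using trichotomy[OF A, of "shift (k1 + int n) p"] n(1) p by (auto simp: above_def shift_in_P)
  then obtain a' where a': "a' \<in> A" "shift (k1 + int n) p \<prec> a'" by (auto simp: Down_def)
  then have "shift (1 + (k1 + int n)) p \<prec> shift 1 a'"
    using prec_shift[of 1 "shift (k1 + int n) p" a'] by simp
  moreover have "1 + (k1 + int n) = k1 + int (Suc n)" by simp
  ultimately have "shift (k1 + int (Suc n)) p \<in> Down (shift 1 ` A)"
    using a'(1) p by (auto simp: Down_def shift_in_P)
  then show ?thesis using n(2) by (auto simp: above_def)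
qed

text \<open>
  If all antichains had at most \<open>w - 1\<close> points, two windows of \<open>h + 1\<close> levels would
  cover a period with at most \<open>4 * (w - 1) \<le> 3 * w\<close> points, as \<open>w \<le> 3\<close>.
\<close>

lemma wide_antichain: "\<exists>A. antichain A \<and> card A = w"
proof (rule ccontr)
  assume neg: "\<not> ?thesis"
  have k: "card A \<le> w - 1" if "antichain A" for A
  proof -
    have "card A \<noteq> w" "card A \<le> w" using neg width that by blast+
    then show ?thesis by simp
  qed
  define S1 S2 where "S1 = {p \<in> P. 0 \<le> snd p \<and> snd p \<le> h}"
    and "S2 = {p \<in> P. h + 1 \<le> snd p \<and> snd p < t}"
  have "{p \<in> P. 0 \<le> snd p \<and> snd p < t} = S1 \<union> S2" using period by (auto simp: S1_def S2_def)
  moreover have "finite S1 \<and> card S1 \<le> 2 * (w - 1)"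
    by (rule window_card[where y = 0]) (use k in \<open>auto simp: S1_def\<close>)
  moreover have "finite S2 \<and> card S2 \<le> 2 * (w - 1)"
    by (rule window_card[where y = "h + 1"]) (use period k in \<open>auto simp: S2_def\<close>)
  ultimately show False using crowded w card_Un_le[of S1 S2] by auto
qed

text \<open>
  The region from \<open>A\<close> up to its translate contains all \<open>3 * w + 1\<close> orbits, but
  \<open>A\<close>, the minimal points above \<open>A\<close> and the maximal points below the translate
  account for at most \<open>3 * w\<close> of them. A point \<open>r\<close> that is none of these has a point
  below and a point above it in the region.
\<close>

lemma middle_chain:
  assumes A: "antichain A" "card A = w"
  obtains a a' b r c where "a \<in> A" "a' \<in> A" "b \<in> P" "r \<in> P" "c \<in> P"
    "a \<prec> b" "b \<prec> r" "r \<prec> c" "c \<prec> shift 1 a'"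
proof -
  define I where "I = (A \<union> Up A) \<inter> Down (shift 1 ` A)"
  define B where "B = {p \<in> Up A. \<forall>q\<in>Up A. \<not> q \<prec> p}"
  define C where "C = {p \<in> Down (shift 1 ` A). \<forall>q\<in>Down (shift 1 ` A). \<not> p \<prec> q}"
  have BC: "antichain B" "antichain C"
    unfolding B_def C_def by (rule minimal_antichain maximal_antichain; auto simp: Up_def Down_def)+
  have "\<not> I \<subseteq> A \<union> B \<union> C"
  proof
    assume sub: "I \<subseteq> A \<union> B \<union> C"
    have fin: "finite (A \<union> B \<union> C)" using A BC width by blast
    have "card (A \<union> B \<union> C) \<le> w + w + w"
      using card_Un_le[of "A \<union> B" C] card_Un_le[of A B] BC width A
      by (meson add_le_mono le_trans)
    moreover have "3 * w + 1 \<le> card (A \<union> B \<union> C)"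
    proof (rule card_transversal[OF fin, unfolded crowded])
      fix p assume "p \<in> P"
      then show "\<exists>m. shift m p \<in> A \<union> B \<union> C"
        using fundamental_domain[OF A] sub unfolding I_def by blast
    qed
    ultimately show False by simp
  qed
  then obtain r where r: "r \<in> I" "r \<notin> A" "r \<notin> B" "r \<notin> C" by blast
  then obtain b where b: "b \<in> Up A" "b \<prec> r" by (auto simp: I_def B_def)
  from r obtain c where c: "c \<in> Down (shift 1 ` A)" "r \<prec> c" by (auto simp: I_def C_def)
  from b(1) obtain a where a: "a \<in> A" "b \<in> P" "a \<prec> b" by (auto simp: Up_def)
  from c(1) obtain a' where a': "a' \<in> A" "c \<in> P" "c \<prec> shift 1 a'" by (auto simp: Down_def)
  have "r \<in> P" using r(1) by (auto simp: I_def Down_def)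
  with a a' b(2) c(2) that show thesis by blast
qed

definition staggered :: "('c \<times> int) set \<Rightarrow> int \<Rightarrow> bool" where
  "staggered A y \<longleftrightarrow> antichain A \<and> card A = w \<and> (\<forall>u\<in>A. snd u = y \<or> snd u = y + 1) \<and>
     (\<exists>u\<in>A. snd u = y) \<and> (\<exists>u\<in>A. snd u = y + 1)"

text \<open>
  In \<open>a \<prec> b \<prec> r \<prec> c \<prec> shift 1 a'\<close> both halves rise by more than
  \<open>h\<close>. As \<open>a'\<close> is at most one level above \<open>a\<close>, there is no room unless
  \<open>t\<close> is odd, \<open>a\<close> is on the lower and \<open>a'\<close> on the upper of two levels,
  and \<open>r\<close> is exactly in the middle. In particular only points of the lower level can be below
  \<open>b\<close>, and only translates of points of the upper level can be above \<open>c\<close>.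
\<close>

lemma staggered_middle_chain:
  assumes A: "antichain A" "card A = w"
  obtains y b r c where "t = 2 * h + 1" "staggered A y" "b \<in> P" "r \<in> P" "c \<in> P"
    "\<exists>a\<in>A. a \<prec> b" "b \<prec> r" "r \<prec> c" "\<exists>a\<in>A. c \<prec> shift 1 a" "snd r = y + h + 1"
    "\<And>u. u \<in> A \<Longrightarrow> u \<prec> b \<Longrightarrow> snd u = y" "\<And>u. u \<in> A \<Longrightarrow> c \<prec> shift 1 u \<Longrightarrow> snd u = y + 1"
proof -
  obtain a a' b r c where *: "a \<in> A" "a' \<in> A" "b \<in> P" "r \<in> P" "c \<in> P"
    "a \<prec> b" "b \<prec> r" "r \<prec> c" "c \<prec> shift 1 a'"
    by (rule middle_chain[OF A])
  have AP: "A \<subseteq> P" using A(1) by (simp add: flat_set_def)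
  have low: "snd u + h < snd r" if "u \<in> A" "u \<prec> b" for u
    using long_chain[of u b r] that * AP by auto
  have high: "snd r + h < snd u + t" if "u \<in> A" "c \<prec> shift 1 u" for u
    using long_chain[of r c "shift 1 u"] that * AP by (auto simp: shift_in_P)
  have "snd a' \<le> snd a + 1" using span[OF A *(2,1)] .
  with low[OF *(1,6)] high[OF *(2,9)] period(1)
  have eq: "t = 2 * h + 1" "snd a' = snd a + 1" "snd r = snd a + h + 1" by auto
  have lev: "snd u = snd a \<or> snd u = snd a + 1" if "u \<in> A" for u
    using span[OF A that *(1)] span[OF A *(2) that] eq(2) by auto
  have stag: "staggered A (snd a)"
    unfolding staggered_def using A lev *(1,2) eq(2) by auto
  show thesis
  proof (rule that[OF eq(1) stag *(3,4,5) _ *(7,8) _ eq(3)])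
    show "\<exists>a\<in>A. a \<prec> b" "\<exists>a\<in>A. c \<prec> shift 1 a" using *(1,2,6,9) by blast+
    show "snd u = snd a" if "u \<in> A" "u \<prec> b" for u
      using low[OF that] lev[OF that(1)] eq by auto
    show "snd u = snd a + 1" if "u \<in> A" "c \<prec> shift 1 u" for u
      using high[OF that] lev[OF that(1)] eq by auto
  qed
qed

definition one_lower :: "'c \<times> int \<Rightarrow> ('c \<times> int) set \<Rightarrow> int \<Rightarrow> bool" where
  "one_lower a M y \<longleftrightarrow> staggered (insert a M) y \<and> a \<notin> M \<and> snd a = y \<and> (\<forall>m\<in>M. snd m = y + 1)"

definition one_upper :: "'c \<times> int \<Rightarrow> ('c \<times> int) set \<Rightarrow> int \<Rightarrow> bool" where
  "one_upper a L y \<longleftrightarrow> staggered (insert a L) y \<and> a \<notin> L \<and> snd a = y + 1 \<and> (\<forall>l\<in>L. snd l = y)"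

lemma staggered_unique: "staggered A y \<Longrightarrow> staggered A z \<Longrightarrow> y = z"
proof -
  assume y: "staggered A y" and z: "staggered A z"
  obtain u v where "u \<in> A" "snd u = y" "v \<in> A" "snd v = y + 1"
    using y by (auto simp: staggered_def)
  moreover from this have "snd u = z \<or> snd u = z + 1" "snd v = z \<or> snd v = z + 1"
    using z by (auto simp: staggered_def)
  ultimately show ?thesis by linarith
qed

lemma staggered_not_level: "staggered A y \<Longrightarrow> \<exists>u\<in>A. snd u \<noteq> z"
  unfolding staggered_def by (metis add_cancel_left_right zero_neq_one)

lemma staggered_cases:
  assumes A: "staggered A y"
  obtains a M where "A = insert a M" "one_lower a M y" | a L where "A = insert a L" "one_upper a L y"
proof -
  define L M where "L = {u \<in> A. snd u = y}" and "M = {u \<in> A. snd u = y + 1}"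
  have fin: "finite A" using A width by (auto simp: staggered_def)
  have "A = L \<union> M" "L \<inter> M = {}" "L \<noteq> {}" "M \<noteq> {}" using A by (auto simp: staggered_def L_def M_def)
  moreover from this have "card A = card L + card M" using fin by (metis card_Un_disjoint finite_Un)
  moreover have "card A = w" "finite L" "finite M" using A fin by (auto simp: staggered_def L_def M_def)
  ultimately have "card L + card M = w" "card L \<noteq> 0" "card M \<noteq> 0" by auto
  then have "card L = 1 \<or> card M = 1" using w by linarith
  then show thesis
  proof
    assume "card L = 1"
    then obtain a where a: "L = {a}" by (metis card_1_singletonE)
    then have "A = insert a M" using \<open>A = L \<union> M\<close> by simp
    moreover from this have "one_lower a M y" using A a unfolding one_lower_def L_def M_def by auto
    ultimately show thesis by (rule that(1))
  next
    assume "card M = 1"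
    then obtain a where a: "M = {a}" by (metis card_1_singletonE)
    then have "A = insert a L" using \<open>A = L \<union> M\<close> by simp
    moreover from this have "one_upper a L y" using A a unfolding one_upper_def L_def M_def by auto
    ultimately show thesis by (rule that(2))
  qed
qed

text \<open>
  The point \<open>b\<close> of the middle chain is above \<open>a\<close> but above no point of
  \<open>M\<close>; it is not below one either, because \<open>a\<close> is not. So \<open>b\<close> can
  replace \<open>a\<close>, and since largest antichains straddle two levels, it has to be one level above
  \<open>M\<close>.
\<close>

lemma one_lower_raise:
  assumes "one_lower a M y"
  shows "\<exists>b. one_upper b M (y + 1) \<and> a \<prec> b"
proof -
  have st: "staggered (insert a M) y" and a: "a \<notin> M" "snd a = y" and M: "\<And>m. m \<in> M \<Longrightarrow> snd m = y + 1"
    using assms by (auto simp: one_lower_def)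
  then have A: "antichain (insert a M)" "card (insert a M) = w" by (auto simp: staggered_def)
  obtain z b r where *: "staggered (insert a M) z" "b \<in> P" "\<exists>u\<in>insert a M. u \<prec> b"
    "\<And>u. u \<in> insert a M \<Longrightarrow> u \<prec> b \<Longrightarrow> snd u = z"
    by (rule staggered_middle_chain[OF A]) blast
  have "z = y" using *(1) st staggered_unique by blast
  have Mb: "\<not> m \<prec> b" if "m \<in> M" for m
    using *(4)[of m] M[OF that] that \<open>z = y\<close> by auto
  then have ab: "a \<prec> b" using *(3) by blast
  have bM: "\<not> b \<prec> m" if "m \<in> M" for m
    using prec_trans[OF ab] A(1) that unfolding flat_set_def by blast
  have "b \<notin> M" using ab A(1) by (auto simp: flat_set_def)
  have B: "antichain (insert b M)"
    using A(1) *(2) Mb bM by (auto simp: flat_set_def steep_def)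
  have "finite M" using A(1) width[of "insert a M"] by simp
  then have cB: "card (insert b M) = w" using A(2) a(1) \<open>b \<notin> M\<close> by simp
  obtain x where x: "staggered (insert b M) x" by (rule staggered_middle_chain[OF B cB]) blast
  obtain m where m: "m \<in> M" using st a(2) by (auto simp: staggered_def)
  have "snd b \<noteq> y + 1"
    using staggered_not_level[OF x, of "y + 1"] M by blast
  moreover have "snd b = x \<or> snd b = x + 1" "snd m = x \<or> snd m = x + 1"
    using x m unfolding staggered_def by blast+
  ultimately have "x = y + 1 \<and> snd b = y + 2"
    using M[OF m] prec_level[OF ab] a(2) by linarith
  then have "one_upper b M (y + 1)" using x \<open>b \<notin> M\<close> M by (auto simp: one_upper_def)
  then show ?thesis using ab by blast
qed

text \<open>
  The mirror image, from the upper end \<open>c\<close> of the middle chain.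
\<close>

lemma one_upper_lower:
  assumes "one_upper a L y"
  shows "\<exists>c. one_lower c L (y - 1) \<and> c \<prec> a"
proof -
  have st: "staggered (insert a L) y" and a: "a \<notin> L" "snd a = y + 1" and L: "\<And>l. l \<in> L \<Longrightarrow> snd l = y"
    using assms by (auto simp: one_upper_def)
  then have A: "antichain (insert a L)" "card (insert a L) = w" by (auto simp: staggered_def)
  obtain z c' where *: "staggered (insert a L) z" "c' \<in> P" "\<exists>u\<in>insert a L. c' \<prec> shift 1 u"
    "\<And>u. u \<in> insert a L \<Longrightarrow> c' \<prec> shift 1 u \<Longrightarrow> snd u = z + 1"
    by (rule staggered_middle_chain[OF A]) blast
  define c where "c = shift (- 1) c'"
  have c'_iff: "c' \<prec> shift 1 u \<longleftrightarrow> c \<prec> u" for u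
    using prec_shift[of 1 c u] by (simp add: c_def)
  have c: "c \<in> P" using *(2) by (simp add: c_def shift_in_P)
  have "z = y" using *(1) st staggered_unique by blast
  have cL: "\<not> c \<prec> l" if "l \<in> L" for l
    using *(4)[of l] L[OF that] that \<open>z = y\<close> by (auto simp: c'_iff)
  then have ca: "c \<prec> a" using *(3) unfolding c'_iff by blast
  have Lc: "\<not> l \<prec> c" if "l \<in> L" for l
    using prec_trans[OF _ ca] A(1) that unfolding flat_set_def by blast
  have "c \<notin> L" using ca A(1) by (auto simp: flat_set_def)
  have B: "antichain (insert c L)"
    using A(1) c Lc cL by (auto simp: flat_set_def steep_def)
  have "finite L" using A(1) width[of "insert a L"] by simp
  then have cB: "card (insert c L) = w" using A(2) a(1) \<open>c \<notin> L\<close> by simp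
  obtain x where x: "staggered (insert c L) x" by (rule staggered_middle_chain[OF B cB]) blast
  obtain l where l: "l \<in> L" using st a(2) by (auto simp: staggered_def)
  have "snd c \<noteq> y"
    using staggered_not_level[OF x, of y] L by blast
  moreover have "snd c = x \<or> snd c = x + 1" "snd l = x \<or> snd l = x + 1"
    using x l unfolding staggered_def by blast+
  ultimately have "x = y - 1 \<and> snd c = y - 1"
    using L[OF l] prec_level[OF ca] a(2) by linarith
  then have "one_lower c L (y - 1)" using x \<open>c \<notin> L\<close> L by (auto simp: one_lower_def)
  then show ?thesis using ca by blast
qed

lemma one_lower_exists: "\<exists>a M y. one_lower a M y"
proof -
  obtain A where A: "antichain A" "card A = w" using wide_antichain by blast
  obtain y where y: "staggered A y" by (rule staggered_middle_chain[OF A]) blast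
  show ?thesis
  proof (rule staggered_cases[OF y])
    fix a M assume "one_lower a M y"
    then show ?thesis by blast
  next
    fix a L assume "one_upper a L y"
    then show ?thesis using one_upper_lower by blast
  qed
qed

lemma odd_period: "t = 2 * h + 1"
proof -
  obtain A where A: "antichain A" "card A = w" using wide_antichain by blast
  show ?thesis by (rule staggered_middle_chain[OF A]) blast
qed

text \<open>
  A period of three levels would have at most \<open>3 * w\<close> points, as every level is an antichain.
\<close>

lemma h_ge_2: "h \<ge> 2"
proof (rule ccontr)
  assume "\<not> ?thesis"
  then have t: "t = 3" using period(2) odd_period by simp
  define Q where "Q i = {p \<in> P. snd p = i}" for i :: int
  have Q: "card (Q i) \<le> w" for i
  proof -
    have "antichain (Q i)" by (rule antichain_level[where y = i]) (auto simp: Q_def)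
    then show ?thesis using width by blast
  qed
  have "{p \<in> P. 0 \<le> snd p \<and> snd p < t} = Q 0 \<union> Q 1 \<union> Q 2"
  proof -
    have "0 \<le> y \<and> y < 3 \<longleftrightarrow> y = 0 \<or> y = 1 \<or> y = 2" for y :: int by linarith
    then show ?thesis unfolding t Q_def by blast
  qed
  then have "3 * w + 1 = card (Q 0 \<union> Q 1 \<union> Q 2)" using crowded by metis
  also have "\<dots> \<le> card (Q 0) + card (Q 1) + card (Q 2)"
    by (rule order_trans[OF card_Un_le add_right_mono[OF card_Un_le]])
  finally show False using Q[of 0] Q[of 1] Q[of 2] by linarith
qed

lemma column_fst: "one_lower a M y \<Longrightarrow> one_upper b M (y + 1) \<Longrightarrow> fst a = fst b"
  by (rule column[of a M b]) (auto simp: one_lower_def one_upper_def staggered_def)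

text \<open>
  Let \<open>b\<close> replace \<open>a\<close>. Nothing but \<open>b\<close> is lost when the points above
  \<open>A = insert a M\<close> are restricted to those above \<open>A' = insert b M\<close>, so a set
  \<open>U\<close> of at least \<open>2 * w\<close> points remains between \<open>A'\<close> and the translate
  of \<open>A\<close>. A point of \<open>U\<close> that is not minimal is on level \<open>y + h + 2\<close> or
  higher, one that is not maximal on level \<open>y + h + 1\<close> or lower. Hence \<open>U\<close> is the
  disjoint union of the minimal points \<open>B\<close> and the maximal points \<open>C\<close>, both of size
  \<open>w\<close>. The middle points of the chains for \<open>A\<close> and for \<open>A'\<close>, on levels
  \<open>y + h + 1\<close> and \<open>y + h + 2\<close>, belong to \<open>B\<close> and \<open>C\<close> and
  fix their levels.
\<close>

lemma one_lower_structure: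
  assumes aM: "one_lower a M y"
  obtains b B C where "one_upper b M (y + 1)" "a \<prec> b" "staggered B (y + h)" "staggered C (y + h + 2)"
    "b \<notin> B" "shift 1 a \<notin> C"
    "\<And>p. p \<in> P \<Longrightarrow> \<exists>m. shift m p \<in> insert a (insert b (M \<union> B \<union> C))"
proof -
  let ?A = "insert a M"
  have A: "antichain ?A" "card ?A = w" and a: "a \<notin> M" "snd a = y" and M: "\<forall>m\<in>M. snd m = y + 1"
    using aM by (auto simp: one_lower_def staggered_def)
  obtain b where b: "one_upper b M (y + 1)" "a \<prec> b" using one_lower_raise[OF aM] by blast
  let ?A' = "insert b M"
  have A': "antichain ?A'" "card ?A' = w" and b': "b \<notin> M" "snd b = y + 2"
    using b(1) by (auto simp: one_upper_def staggered_def)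
  define T where "T = shift 1 ` ?A"
  have T: "antichain T" "card T = w"
    unfolding T_def using antichain_shift[OF A(1)] card_shift A(2) by metis+
  have T_level: "snd p = y + t \<or> snd p = y + t + 1" if "p \<in> T" for p
    using that a(2) M by (auto simp: T_def)
  have A_level: "snd p \<ge> y" if "p \<in> ?A" for p using that a(2) M by auto
  have A'_level: "snd p \<ge> y + 1" if "p \<in> ?A'" for p using that b'(2) M by auto
  have AP: "?A \<subseteq> P" "?A' \<subseteq> P" "T \<subseteq> P" using A(1) A'(1) T(1) by (simp_all add: flat_set_def)
  define U where "U = Up ?A' \<inter> Down T"
  define B where "B = {p \<in> U. \<forall>q\<in>Up ?A'. \<not> q \<prec> p}"
  define C where "C = {p \<in> U. \<forall>q\<in>Down T. \<not> p \<prec> q}"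
  have UP: "U \<subseteq> P" unfolding U_def Up_def by blast
  have notB: "y + h + 2 \<le> snd p" if "p \<in> U" "p \<notin> B" for p
  proof -
    obtain q where "q \<in> Up ?A'" "q \<prec> p" using \<open>p \<in> U\<close> \<open>p \<notin> B\<close> unfolding B_def by blast
    then obtain u where "u \<in> ?A'" "u \<prec> q" "q \<in> P" unfolding Up_def by blast
    then have "h < snd p - snd u" using long_chain[of u q p] \<open>q \<prec> p\<close> \<open>p \<in> U\<close> AP(2) UP by blast
    then show ?thesis using A'_level[OF \<open>u \<in> ?A'\<close>] by simp
  qed
  have notC: "snd p \<le> y + h + 1" if "p \<in> U" "p \<notin> C" for p
  proof -
    obtain q where "q \<in> Down T" "p \<prec> q" using \<open>p \<in> U\<close> \<open>p \<notin> C\<close> unfolding C_def by blast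
    then obtain u where "u \<in> T" "q \<prec> u" "q \<in> P" unfolding Down_def by blast
    then have "h < snd u - snd p" using long_chain[of p q u] \<open>p \<prec> q\<close> \<open>p \<in> U\<close> AP(3) UP by blast
    then show ?thesis using T_level[OF \<open>u \<in> T\<close>] odd_period by auto
  qed
  have U: "U = B \<union> C"
  proof -
    have "p \<in> B \<or> p \<in> C" if "p \<in> U" for p using notB[OF that] notC[OF that] by force
    then show ?thesis unfolding B_def C_def by blast
  qed
  have UU: "U \<subseteq> Up ?A'" "U \<subseteq> Down T" by (auto simp: U_def)
  have BC: "antichain B" "antichain C" using UP UU unfolding flat_set_def B_def C_def by blast+
  \<comment> \<open>A point above \<open>A\<close> and below \<open>b\<close> would be the middle of a chain that rises by two levels only.\<close>
  have lifted: "p \<in> ?A' \<union> Up ?A'" if "p \<in> ?A \<union> Up ?A" "p \<noteq> a" for p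
  proof (cases "p \<in> M")
    case False
    then have p: "p \<in> Up ?A" using that by auto
    then obtain u where u: "u \<in> ?A" "u \<prec> p" "p \<in> P" unfolding Up_def by blast
    have "p \<notin> Down ?A'"
    proof
      assume "p \<in> Down ?A'"
      then obtain v where v: "v \<in> ?A'" "p \<prec> v" unfolding Down_def by blast
      show False
      proof (cases "v = b")
        case True
        then have "h < snd b - snd u" using long_chain[of u p b] u v AP by auto
        then show False using A_level[OF u(1)] b'(2) h_ge_2 by simp
      next
        case False
        then show False using v u prec_trans A(1) unfolding flat_set_def by blast
      qed
    qed
    then show ?thesis using trichotomy[OF A' u(3)] by blast
  qed simp
  have cover: "\<exists>m. shift m p \<in> insert a (insert b (M \<union> B \<union> C))" if pP: "p \<in> P" for p
  proof -
    obtain m where m: "shift m p \<in> ?A \<union> Up ?A" "shift m p \<in> Down T"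
      using fundamental_domain[OF A pP] unfolding T_def by blast
    then have "shift m p \<in> insert a (?A' \<union> U)" using lifted[OF m(1)] unfolding U_def by blast
    then show ?thesis using U by blast
  qed
  have fin: "finite (insert a M)" "finite B" "finite C" "card B \<le> w" "card C \<le> w"
    using width[OF A(1)] width[OF BC(1)] width[OF BC(2)] by simp_all
  then have finX: "finite (?A \<union> (B \<union> C))" by simp
  have X: "insert a (insert b (M \<union> B \<union> C)) = insert b (?A \<union> (B \<union> C))" by auto
  have "3 * w + 1 \<le> card (insert a (insert b (M \<union> B \<union> C)))"
  proof (rule card_transversal[unfolded crowded])
    show "finite (insert a (insert b (M \<union> B \<union> C)))" unfolding X using finX by simp
  qed (rule cover)
  also have "\<dots> \<le> Suc (card (?A \<union> (B \<union> C)))"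
    unfolding X using finX by (simp add: card_insert_if)
  also have "card (?A \<union> (B \<union> C)) \<le> card ?A + card (B \<union> C)" by (rule card_Un_le)
  finally have "2 * w \<le> card (B \<union> C)" using A(2) by simp
  then have "card B = w \<and> card C = w \<and> card (B \<inter> C) = 0"
    using fin card_Un_Int[of B C] by linarith
  then have cBC: "card B = w" "card C = w" "B \<inter> C = {}"
    using fin by simp_all
  obtain yB where sB: "staggered B yB" by (rule staggered_middle_chain[OF BC(1) cBC(1)]) blast
  obtain yC where sC: "staggered C yC" by (rule staggered_middle_chain[OF BC(2) cBC(2)]) blast
  have yB: "yB \<le> y + h"
  proof -
    obtain p where "p \<in> B" "snd p = yB + 1" using sB unfolding staggered_def by blast
    moreover from this have "p \<in> U" "p \<notin> C" using U cBC(3) by blast+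
    ultimately show ?thesis using notC[of p] by simp
  qed
  have yC: "y + h + 2 \<le> yC"
  proof -
    obtain p where "p \<in> C" "snd p = yC" using sC unfolding staggered_def by blast
    moreover from this have "p \<in> U" "p \<notin> B" using U cBC(3) by blast+
    ultimately show ?thesis using notB[of p] by simp
  qed
  obtain y1 b1 r c1 where r: "staggered ?A y1" "b1 \<in> P" "r \<in> P" "c1 \<in> P" "\<exists>u\<in>?A. u \<prec> b1" "b1 \<prec> r"
    "r \<prec> c1" "\<exists>u\<in>?A. c1 \<prec> shift 1 u" "snd r = y1 + h + 1"
    by (rule staggered_middle_chain[OF A]) blast
  have "y1 = y" using r(1) aM staggered_unique unfolding one_lower_def by blast
  have "r \<in> Up ?A" using r(3,5,6) prec_trans unfolding Up_def by blast
  moreover have "r \<noteq> a" using r(9) \<open>y1 = y\<close> a(2) period(2) by auto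
  moreover have "r \<notin> ?A'" using r(9) \<open>y1 = y\<close> b'(2) M h_ge_2 by auto
  moreover have "r \<in> Down T" using r(3,7,8) prec_trans unfolding Down_def T_def by blast
  ultimately have "r \<in> U" using lifted[of r] unfolding U_def by blast
  then have "r \<in> B" using notB[of r] r(9) \<open>y1 = y\<close> by auto
  then have "yB = y + h" using sB yB r(9) \<open>y1 = y\<close> by (auto simp: staggered_def)
  obtain y2 b2 r2 c2 where r2: "staggered ?A' y2" "b2 \<in> P" "r2 \<in> P" "c2 \<in> P" "\<exists>u\<in>?A'. u \<prec> b2" "b2 \<prec> r2"
    "r2 \<prec> c2" "\<exists>u\<in>?A'. c2 \<prec> shift 1 u" "snd r2 = y2 + h + 1"
    by (rule staggered_middle_chain[OF A']) blast
  have "y2 = y + 1" using r2(1) b(1) staggered_unique unfolding one_upper_def by blast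
  have lev2: "snd r2 < y + t" using r2(9) \<open>y2 = y + 1\<close> h_ge_2 odd_period by simp
  have low2: "snd r2 < snd p" if "p \<in> T" for p using T_level[OF that] lev2 by linarith
  then have "r2 \<notin> T" by blast
  moreover have "r2 \<notin> Up T"
  proof
    assume "r2 \<in> Up T"
    then obtain p where "p \<in> T" "p \<prec> r2" unfolding Up_def by blast
    then show False using low2[of p] prec_level[of p r2] by simp
  qed
  ultimately have "r2 \<in> Down T" using trichotomy[OF T r2(3)] by blast
  moreover have "r2 \<in> Up ?A'" using r2(3,5,6) prec_trans unfolding Up_def by blast
  ultimately have "r2 \<in> U" by (simp add: U_def)
  then have "r2 \<in> C" using notC[of r2] r2(9) \<open>y2 = y + 1\<close> by auto
  then have "yC = y + h + 2" using sC yC r2(9) \<open>y2 = y + 1\<close> by (auto simp: staggered_def)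
  have "b \<notin> B" using Up_Down_disjoint(1)[OF A'(1), of b] unfolding B_def U_def by blast
  moreover have "shift 1 a \<notin> C"
  proof
    assume "shift 1 a \<in> C"
    then obtain u where "u \<in> T" "shift 1 a \<prec> u" unfolding C_def U_def Down_def by blast
    then show False using T(1) unfolding flat_set_def T_def by blast
  qed
  ultimately show thesis
    using that[OF b] sB sC \<open>yB = y + h\<close> \<open>yC = y + h + 2\<close> cover by blast
qed

lemma one_lowerD:
  assumes "one_lower a M y"
  shows "a \<in> P" "snd a = y" "m \<in> M \<Longrightarrow> snd m = y + 1"
  using assms by (simp_all add: one_lower_def staggered_def flat_set_def)

lemma one_upperD:
  assumes "one_upper b L y"
  shows "b \<in> P" "snd b = y + 1" "l \<in> L \<Longrightarrow> snd l = y"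
  using assms by (simp_all add: one_upper_def staggered_def flat_set_def)

lemma staggeredD:
  assumes "staggered A y"
  shows "A \<subseteq> P" "u \<in> A \<Longrightarrow> snd u = y \<or> snd u = y + 1"
  using assms by (simp_all add: staggered_def flat_set_def)

lemma staggered_inhabited:
  assumes "staggered A y"
  shows "\<exists>u\<in>A. snd u = y" "\<exists>u\<in>A. snd u = y + 1"
  using assms by (simp_all add: staggered_def)

lemma pattern_level:
  assumes "one_lower a M y" "one_upper b M (y + 1)" "staggered B z" "staggered C z'"
    and "q \<in> insert a (insert b (M \<union> B \<union> C))"
  shows "(q = a \<and> snd q = y) \<or> (q \<in> M \<and> snd q = y + 1) \<or> (q = b \<and> snd q = y + 2) \<or>
    (q \<in> B \<and> (snd q = z \<or> snd q = z + 1)) \<or> (q \<in> C \<and> (snd q = z' \<or> snd q = z' + 1))"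
proof -
  have "snd b = y + 2" using one_upperD(2)[OF assms(2)] by simp
  then show ?thesis
    using assms(5) one_lowerD(2,3)[OF assms(1)] staggeredD(2)[OF assms(3)] staggeredD(2)[OF assms(4)]
    by blast
qed

text \<open>
  If \<open>h \<ge> 3\<close>, the levels from \<open>y\<close> to \<open>y + h + 3\<close> fit into one
  period, so that no translation is needed.
\<close>

lemma one_lower_period:
  assumes aM: "one_lower a M y" and h: "h \<ge> 3"
  obtains b B C where "one_upper b M (y + 1)" "a \<prec> b" "staggered B (y + h)" "staggered C (y + h + 2)"
    "\<And>p. p \<in> P \<Longrightarrow> y \<le> snd p \<Longrightarrow> snd p < y + t \<Longrightarrow> p \<in> insert a (insert b (M \<union> B \<union> C))"
proof (rule one_lower_structure[OF aM])
  fix b B C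
  assume *: "one_upper b M (y + 1)" "a \<prec> b" "staggered B (y + h)" "staggered C (y + h + 2)"
    and cover: "\<And>p. p \<in> P \<Longrightarrow> \<exists>m. shift m p \<in> insert a (insert b (M \<union> B \<union> C))"
  have "p \<in> insert a (insert b (M \<union> B \<union> C))" if p: "p \<in> P" "y \<le> snd p" "snd p < y + t" for p
  proof -
    obtain m where m: "shift m p \<in> insert a (insert b (M \<union> B \<union> C))" using cover[OF p(1)] by blast
    have "y \<le> snd p + m * t" "snd p + m * t \<le> y + h + 3"
      using pattern_level[OF aM *(1,3,4) m] h unfolding snd_shift by linarith+
    then have "m = 0" using multiple_cases[of m] p(2,3) odd_period h by linarith
    then show ?thesis using m by simp
  qed
  then show thesis using that[OF *] by blast
qed

text \<open>
  The antichain \<open>B\<close> straddles the levels \<open>y + h\<close> and \<open>y + h + 1\<close>. If it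
  has a single lower point, the pattern based at \<open>y + h\<close> leaves no place for the points of
  \<open>C\<close> on level \<open>y + h + 3\<close>; if it has a single upper point, lowering that point
  leads to the level \<open>y + h - 1\<close>, which is empty in the pattern based at \<open>y\<close>.
\<close>

lemma h_le_3: "h \<le> 3"
proof (rule ccontr)
  assume "\<not> ?thesis"
  then have h: "h \<ge> 4" "h \<ge> 3" by simp_all
  obtain a M y where aM: "one_lower a M y" using one_lower_exists by blast
  obtain b B C where *: "one_upper b M (y + 1)" "staggered B (y + h)" "staggered C (y + h + 2)"
    and cover: "\<And>p. p \<in> P \<Longrightarrow> y \<le> snd p \<Longrightarrow> snd p < y + t \<Longrightarrow> p \<in> insert a (insert b (M \<union> B \<union> C))"
    by (rule one_lower_period[OF aM h(2)]) blast
  show False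
  proof (rule staggered_cases[OF *(2)])
    fix l K assume lK: "B = insert l K" "one_lower l K (y + h)"
    obtain b' B' C' where **: "one_upper b' K (y + h + 1)" "staggered B' (y + h + h)" "staggered C' (y + h + h + 2)"
      and cover': "\<And>p. p \<in> P \<Longrightarrow> y + h \<le> snd p \<Longrightarrow> snd p < y + h + t \<Longrightarrow> p \<in> insert l (insert b' (K \<union> B' \<union> C'))"
      by (rule one_lower_period[OF lK(2) h(2)]) blast
    obtain p where p: "p \<in> C" "snd p = y + h + 2 + 1" using staggered_inhabited(2)[OF *(3)] by blast
    then have "p \<in> P" using staggeredD(1)[OF *(3)] by blast
    then have "p \<in> insert l (insert b' (K \<union> B' \<union> C'))" using cover'[of p] p(2) odd_period h by simp
    then show False
      using pattern_level[OF lK(2) **, of p] p(2) h(1) by linarith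
  next
    fix u L assume uL: "B = insert u L" "one_upper u L (y + h)"
    then obtain c where c: "one_lower c L (y + h - 1)" using one_upper_lower by blast
    have cP: "c \<in> P" "snd c = y + h - 1" using one_lowerD(1,2)[OF c] by auto
    then have "c \<in> insert a (insert b (M \<union> B \<union> C))" using cover[of c] odd_period h by simp
    then show False
      using pattern_level[OF aM *, of c] cP(2) h(1) by linarith
  qed
qed

text \<open>
  For \<open>h = 3\<close> and \<open>t = 7\<close> the pattern based at \<open>y\<close> fills the seven
  levels of a period, and raising or lowering the single points of the antichains \<open>A\<close>,
  \<open>B\<close> and \<open>C\<close> leads to a single point of the next one. As each move keeps the
  column, this puts three points into one column that differ by at most three levels.
\<close>

lemma h_ne_3: "h \<noteq> 3"
proof
  assume h: "h = 3"
  then have h3: "h \<ge> 3" and t: "t = 7" using odd_period by simp_all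
  have no_column_chain: False if "u \<in> P" "v \<in> P" "z \<in> P" "fst u = fst v" "fst v = fst z"
    "snd u < snd v" "snd v < snd z" "snd z \<le> snd u + 3" for u v z
    using long_chain[OF that(1,2,3) prec_column prec_column] that h by simp
  obtain a M y where aM: "one_lower a M y" using one_lower_exists by blast
  obtain b B C where *: "one_upper b M (y + 1)" "staggered B (y + h)" "staggered C (y + h + 2)"
    and cover: "\<And>p. p \<in> P \<Longrightarrow> y \<le> snd p \<Longrightarrow> snd p < y + t \<Longrightarrow> p \<in> insert a (insert b (M \<union> B \<union> C))"
    by (rule one_lower_period[OF aM h3]) blast
  have a: "a \<in> P" "snd a = y" and b: "b \<in> P" "snd b = y + 2"
    using one_lowerD(1,2)[OF aM] one_upperD(1,2)[OF *(1)] by simp_all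
  have place: "(snd p = y \<longrightarrow> p = a) \<and> (snd p = y + 2 \<longrightarrow> p = b) \<and>
      (snd p = y + 4 \<longrightarrow> p \<in> B) \<and> (snd p = y + 5 \<longrightarrow> p \<in> C)"
    if "p \<in> P" "y \<le> snd p" "snd p < y + 7" for p
  proof -
    have "p \<in> insert a (insert b (M \<union> B \<union> C))" using cover[OF that(1,2)] that(3) t by simp
    note lev = pattern_level[OF aM * this]
    have "p = a" if "snd p = y" using lev h that by linarith
    moreover have "p = b" if "snd p = y + 2" using lev h that by linarith
    moreover have "p \<in> B" if "snd p = y + 4" using lev h that by linarith
    moreover have "p \<in> C" if "snd p = y + 5" using lev h that by linarith
    ultimately show ?thesis by blast
  qed
  have ab: "fst a = fst b" using column_fst[OF aM *(1)] .
  have wrap: "fst p = fst a" if "p \<in> P" "snd p = y + 7" for p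
  proof -
    have "snd (shift (- 1) p) = y" unfolding snd_shift using that(2) t by simp
    then have "shift (- 1) p = a" using place[OF shift_in_P[OF that(1), of "- 1"]] by simp
    then show ?thesis using fst_shift[of "- 1" p] by simp
  qed
  show False
  proof (rule staggered_cases[OF *(2)])
    fix l K assume lK: "B = insert l K" "one_lower l K (y + h)"
    obtain b' B' C' where **: "one_upper b' K (y + h + 1)" "staggered B' (y + h + h)" "staggered C' (y + h + h + 2)"
      and cover': "\<And>p. p \<in> P \<Longrightarrow> y + h \<le> snd p \<Longrightarrow> snd p < y + h + t \<Longrightarrow> p \<in> insert l (insert b' (K \<union> B' \<union> C'))"
      by (rule one_lower_period[OF lK(2) h3]) blast
    have l: "l \<in> P" "snd l = y + 3" and b': "b' \<in> P" "snd b' = y + 5"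
      using one_lowerD(1,2)[OF lK(2)] one_upperD(1,2)[OF **(1)] h by simp_all
    have lb: "fst l = fst b'" using column_fst[OF lK(2) **(1)] .
    have unique: "p = b'" if "p \<in> P" "snd p = y + 5" for p
      using pattern_level[OF lK(2) **, of p] cover'[OF that(1)] that(2) t h by simp
    have "b' \<in> C" using place[OF b'(1)] b'(2) by simp
    then have insb: "insert b' (C - {b'}) = C" by blast
    have upper: "snd p = y + 6" if "p \<in> C - {b'}" for p
    proof -
      have p: "p \<in> C" "p \<noteq> b'" "p \<in> P" using that staggeredD(1)[OF *(3)] by blast+
      then have "snd p \<noteq> y + 5" using unique by blast
      then show ?thesis using staggeredD(2)[OF *(3) p(1)] h by linarith
    qed
    have low: "one_lower b' (C - {b'}) (y + h + 2)"
      unfolding one_lower_def insb using *(3) h b'(2) upper by simp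
    obtain e where e: "one_upper e (C - {b'}) (y + h + 2 + 1)" using one_lower_raise[OF low] by blast
    have "fst e = fst a" using wrap one_upperD(1,2)[OF e] h by simp
    then have "fst b = fst l" using column_fst[OF low e] ab lb by simp
    then show False by (rule no_column_chain[OF b(1) l(1) b'(1) _ lb]) (use b(2) l(2) b'(2) in simp_all)
  next
    fix u L assume uL: "B = insert u L" "one_upper u L (y + h)"
    have u: "u \<in> P" "snd u = y + 4" and L: "\<And>l. l \<in> L \<Longrightarrow> snd l = y + 3"
      using one_upperD[OF uL(2)] h by simp_all
    have "y + 2 + 1 = y + h" using h by simp
    with uL(2) have uL': "one_upper u L (y + 2 + 1)" by (simp only:)
    obtain c where c: "one_lower c L (y + 2)" using one_upper_lower[OF uL', unfolded add_diff_cancel_right'] by blast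
    have cP: "c \<in> P" "snd c = y + 2" using one_lowerD(1,2)[OF c] by simp_all
    then have "c = b" using place[of c] by simp
    then have bu: "fst b = fst u" using column_fst[OF c uL'] by simp
    show False
    proof (rule staggered_cases[OF *(3)])
      fix l K assume lK: "C = insert l K" "one_lower l K (y + h + 2)"
      obtain e where e: "one_upper e K (y + h + 2 + 1)" using one_lower_raise[OF lK(2)] by blast
      have eP: "e \<in> P" "snd e = y + 7" using one_upperD(1,2)[OF e] h by simp_all
      have l: "l \<in> P" "snd l = y + 5" using one_lowerD(1,2)[OF lK(2)] h by simp_all
      have le: "fst l = fst e" by (rule column_fst[OF lK(2) e])
      have "fst u = fst l" using wrap[OF eP] le ab bu by simp
      then show False by (rule no_column_chain[OF u(1) l(1) eP(1) _ le]) (use u(2) l(2) eP(2) in simp_all)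
    next
      fix v K assume vK: "C = insert v K" "one_upper v K (y + h + 2)"
      have v: "v \<in> P" "snd v = y + 6" using one_upperD(1,2)[OF vK(2)] h by simp_all
      have "y + 4 + 1 = y + h + 2" using h by simp
      with vK(2) have vK': "one_upper v K (y + 4 + 1)" by (simp only:)
      obtain f where f: "one_lower f K (y + 4)" using one_upper_lower[OF vK', unfolded add_diff_cancel_right'] by blast
      have fP: "f \<in> P" "snd f = y + 4" using one_lowerD(1,2)[OF f] by simp_all
      then have "f \<in> B" using place[of f] by simp
      moreover have "f \<notin> L" using L[of f] fP(2) by linarith
      ultimately have "f = u" using uL(1) by blast
      then have "fst (shift (- 1) v) = fst a" using column_fst[OF f vK'] ab bu by simp
      moreover have "snd (shift (- 1) v) = y - 1" unfolding snd_shift using v(2) t by simp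
      ultimately show False
        by (intro no_column_chain[OF shift_in_P[OF v(1), of "- 1"] a(1) b(1) _ ab])
          (use a(2) b(2) in simp_all)
    qed
  qed
qed

text \<open>
  The remaining case. Both \<open>C\<close>, translated downwards, and \<open>B\<close> reach into the cluster
  of \<open>A\<close>, which gives further points \<open>u\<close> and \<open>v\<close> on the levels of
  \<open>a\<close> and \<open>b\<close>. Two points of one level are an antichain that does not straddle two
  levels, which rules out \<open>w = 2\<close>.
\<close>

lemma period_five:
  obtains a M b u v y where "h = 2" "w = 3" "t = 5" "one_lower a M y" "one_upper b M (y + 1)"
    "u \<in> P" "u \<noteq> a" "snd u = y" "v \<in> P" "v \<noteq> b" "snd v = y + 2"
proof -
  have h: "h = 2" and t: "t = 5" using h_ge_2 h_le_3 h_ne_3 odd_period by linarith+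
  obtain a M y where aM: "one_lower a M y" using one_lower_exists by blast
  obtain b B C where *: "one_upper b M (y + 1)" "staggered B (y + h)" "staggered C (y + h + 2)" "b \<notin> B" "shift 1 a \<notin> C"
    by (rule one_lower_structure[OF aM]) blast
  obtain v where v: "v \<in> B" "snd v = y + h" using staggered_inhabited(1)[OF *(2)] by blast
  obtain u where u: "u \<in> C" "snd u = y + h + 2 + 1" using staggered_inhabited(2)[OF *(3)] by blast
  have uv: "u \<in> P" "v \<in> P" "v \<noteq> b" using u(1) v(1) *(4) staggeredD(1)[OF *(2)] staggeredD(1)[OF *(3)] by blast+
  have u': "shift (- 1) u \<in> P" "snd (shift (- 1) u) = y"
    unfolding snd_shift using shift_in_P[OF uv(1)] u(2) t h by simp_all
  have ua: "shift (- 1) u \<noteq> a" using u(1) *(5) shift_shift[of 1 "- 1" u] by auto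
  have aP: "a \<in> P" "snd a = y" using one_lowerD(1,2)[OF aM] by simp_all
  have "w \<noteq> 2"
  proof
    assume w2: "w = 2"
    let ?Q = "{a, shift (- 1) u}"
    have Q: "antichain ?Q" by (rule antichain_level[where y = y]) (use u' aP in auto)
    have "card ?Q = w" using ua w2 by auto
    from staggered_middle_chain[OF Q this] obtain x where "staggered ?Q x" by metis
    then show False using u'(2) aP(2) by (auto simp: staggered_def)
  qed
  then have "w = 3" using w by simp
  then show thesis using that[OF h _ t aM *(1) u'(1) ua u'(2) uv(2,3)] v(2) h by simp
qed

end

section \<open>General position in cycles\<close>

lemma between_freeD:
  "\<lbrakk>between_free d S; u \<in> S; v \<in> S; z \<in> S; u \<noteq> v; u \<noteq> z; v \<noteq> z\<rbrakk> \<Longrightarrow> d u v \<noteq> d u z + d z v"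
  by (simp add: between_free_def)

lemma between_free_subset: "between_free d S \<Longrightarrow> T \<subseteq> S \<Longrightarrow> between_free d T"
  by (auto simp: between_free_def)

abbreviation cycle_metric :: "nat \<Rightarrow> nat \<Rightarrow> nat \<Rightarrow> int" where
  "cycle_metric n i j \<equiv> cyc_dist n (int i) (int j)"

lemma increasing_elements:
  fixes X :: "nat set"
  assumes "finite X" "k \<le> card X"
  shows "\<exists>f. (\<forall>i<k. f i \<in> X) \<and> (\<forall>i<k. \<forall>j<i::nat. f j < f i)"
proof -
  define xs where "xs = sorted_list_of_set X"
  have xs: "length xs = card X" "set xs = X" "sorted_wrt (<) xs" using assms by (simp_all add: xs_def)
  have "\<forall>i<k. xs ! i \<in> X" using xs(1,2) assms(2) by (metis nth_mem order_less_le_trans)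
  moreover have "\<forall>i<k. \<forall>j<i. xs ! j < xs ! i"
    using xs(1,3) assms(2) by (simp add: sorted_wrt_iff_nth_less)
  ultimately show ?thesis by blast
qed

text \<open>
  Of four vertices in cyclic order, consider the first and the third. Each of the two arcs between them
  contains one of the other vertices, and one of these arcs is a shortest path.
\<close>

lemma cycle_between_free_card_le_3:
  assumes X: "X \<subseteq> {..<n}" "between_free (cycle_metric n) X"
  shows "card X \<le> 3"
proof (rule ccontr)
  assume "\<not> ?thesis"
  then obtain f :: "nat \<Rightarrow> nat" where f: "\<forall>i<4. f i \<in> X" "\<forall>i<4. \<forall>j<i. f j < f i"
    using increasing_elements[of X 4] finite_subset[OF X(1)] by auto
  define a b c e where "a = f 0" and "b = f 1" and "c = f 2" and "e = f 3"
  have in_X: "a \<in> X" "b \<in> X" "c \<in> X" "e \<in> X" and lt: "a < b" "b < c" "c < e"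
    using f by (auto simp: a_def b_def c_def e_def)
  have o: "a < b" "b < c" "c < e" "e < n" using lt in_X(4) X(1) by auto
  have dist: "cycle_metric n i j = min (int j - int i) (int n - (int j - int i))" if "i < j" "j < n" for i j
    using that by (subst cyc_dist_eq_abs) auto
  have "cycle_metric n a c \<noteq> cycle_metric n a b + cycle_metric n b c"
    using between_freeD[OF X(2)] in_X o by simp
  moreover have "cycle_metric n a c \<noteq> cycle_metric n a e + cycle_metric n e c"
    using between_freeD[OF X(2)] in_X o by simp
  ultimately show False
    using o by (simp add: dist cyc_dist_sym[of n "int e" "int c"])
qed

text \<open>
  The remaining facts concern cycles of at most six vertices and are checked vertex by vertex.
\<close>

lemma less_4_cases: "x < 4 \<Longrightarrow> x = 0 \<or> x = 1 \<or> x = 2 \<or> x = 3" for x :: nat by linarith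
lemma less_5_cases: "x < 5 \<Longrightarrow> x = 0 \<or> x = 1 \<or> x = 2 \<or> x = 3 \<or> x = 4" for x :: nat by linarith
lemma less_6_cases: "x < 6 \<Longrightarrow> x = 0 \<or> x = 1 \<or> x = 2 \<or> x = 3 \<or> x = 4 \<or> x = 5" for x :: nat by linarith

lemma cycle_4_between_free_card_le_2:
  assumes X: "X \<subseteq> {..<4}" "between_free (cycle_metric 4) X"
  shows "card X \<le> 2"
proof (rule ccontr)
  assume "\<not> ?thesis"
  then obtain f :: "nat \<Rightarrow> nat" where f: "\<forall>i<3. f i \<in> X" "\<forall>i<3. \<forall>j<i. f j < f i"
    using increasing_elements[of X 3] finite_subset[OF X(1)] by auto
  define a b c where "a = f 0" and "b = f 1" and "c = f 2"
  have in_X: "a \<in> X" "b \<in> X" "c \<in> X" and lt: "a < b" "b < c"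
    using f by (auto simp: a_def b_def c_def)
  have o: "a < b" "b < c" "c < 4" using lt in_X(3) X(1) by auto
  have "cycle_metric 4 a c \<noteq> cycle_metric 4 a b + cycle_metric 4 b c"
    "cycle_metric 4 a b \<noteq> cycle_metric 4 a c + cycle_metric 4 c b"
    "cycle_metric 4 b c \<noteq> cycle_metric 4 b a + cycle_metric 4 a c"
    using between_freeD[OF X(2)] in_X o by simp_all
  then show False
    using o less_4_cases[of a] less_4_cases[of b] less_4_cases[of c] by (auto simp: cyc_dist_def)
qed

text \<open>
  The three arcs between the vertices have total length six. None has length three or more, since then the
  opposite way, through the third vertex, would be a shortest path. So all three have length two.
\<close>

lemma cycle_6_triple:
  assumes "a < 6" "b < 6" "c < 6" "a \<noteq> b" "a \<noteq> c" "b \<noteq> c" "between_free (cycle_metric 6) {a, b, c}"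
  shows "cycle_metric 6 a b = 2"
proof -
  have "cycle_metric 6 a c \<noteq> cycle_metric 6 a b + cycle_metric 6 b c"
    "cycle_metric 6 a b \<noteq> cycle_metric 6 a c + cycle_metric 6 c b"
    "cycle_metric 6 b c \<noteq> cycle_metric 6 b a + cycle_metric 6 a c"
    using between_freeD[OF assms(7)] assms(4-6) by simp_all
  then show ?thesis
    using assms(4-6) less_6_cases[OF assms(1)] less_6_cases[OF assms(2)] less_6_cases[OF assms(3)]
    by (elim disjE) (simp_all add: cyc_dist_def)
qed

text \<open>
  In each of $C_4$, $C_5$ and $C_6$ the other members of a largest antichain determine the column of a member
  that is one level below or above all of them.
\<close>

lemma cycle_4_far_unique:
  assumes "a < 4" "b < 4" "m < 4" "cycle_metric 4 a m > 1" "cycle_metric 4 b m > 1"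
  shows "a = b"
  using assms(4,5) less_4_cases[OF assms(1)] less_4_cases[OF assms(2)] less_4_cases[OF assms(3)]
  by (elim disjE) (simp_all add: cyc_dist_def)

lemma cycle_5_far_unique:
  assumes "a < 5" "b < 5" "m < 5" "k < 5" "m \<noteq> k"
    "cycle_metric 5 a m > 1" "cycle_metric 5 b m > 1" "cycle_metric 5 a k > 1" "cycle_metric 5 b k > 1"
  shows "a = b"
  using assms(5-) less_5_cases[OF assms(1)] less_5_cases[OF assms(2)] less_5_cases[OF assms(3)] less_5_cases[OF assms(4)]
  by (elim disjE) (simp_all add: cyc_dist_def)

lemma cycle_6_triple_unique:
  assumes "a < 6" "b < 6" "m < 6" "k < 6" "cycle_metric 6 m k = 2"
    "cycle_metric 6 a m = 2" "cycle_metric 6 b m = 2" "cycle_metric 6 a k = 2" "cycle_metric 6 b k = 2"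
  shows "a = b"
  using assms(5-) less_6_cases[OF assms(1)] less_6_cases[OF assms(2)] less_6_cases[OF assms(3)] less_6_cases[OF assms(4)]
  by (elim disjE) (simp_all add: cyc_dist_def)

lemma cyc_dist_le_half:
  assumes "i < n" "j < n" shows "2 * cycle_metric n i j \<le> int n"
  using assms by (subst cyc_dist_eq_abs) (auto simp: min_def)

text \<open>
  The general position number of a cycle, by \<open>cycle_between_free_card_le_3\<close>,
  \<open>cycle_4_between_free_card_le_2\<close> and \<open>cycle_gp_attained\<close> below.
\<close>

definition cycle_gp :: "nat \<Rightarrow> nat" where
  "cycle_gp n = (if n = 4 then 2 else 3)"

section \<open>Unrolling the second cycle\<close>

text \<open>
  The condition on \<open>s div 2\<close> makes sure that the levels of an antichain differ by at most half a
  period, so that they are at their true distance in the second cycle.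
\<close>

locale torus_set =
  fixes s t :: nat and S :: "(nat \<times> nat) set"
  assumes s: "s \<in> {3, 4, 5, 6}" and t: "t \<ge> 3" and st: "s div 2 \<le> t div 2 + 1"
    and S: "S \<subseteq> {..<s} \<times> {..<t}" and bf: "between_free (torus_dist s t) S"
begin

definition proj :: "nat \<times> int \<Rightarrow> nat \<times> nat" where
  "proj p = (fst p, nat (snd p mod int t))"

definition P :: "(nat \<times> int) set" where
  "P = {p. proj p \<in> S}"

abbreviation d where "d \<equiv> cycle_metric s"
abbreviation h where "h \<equiv> int t div 2"
abbreviation w where "w \<equiv> cycle_gp s"

lemma fst_P: "p \<in> P \<Longrightarrow> fst p < s"
  using S by (auto simp: P_def proj_def)

lemma torus_dist_proj: "torus_dist s t (proj u) (proj v) = max (d (fst u) (fst v)) (cyc_dist t (snd u) (snd v))"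
  using t by (simp add: torus_dist_def proj_def)

lemma proj_neq:
  assumes "u \<noteq> v" "2 * \<bar>snd u - snd v\<bar> \<le> int t" shows "proj u \<noteq> proj v"
proof
  assume eq: "proj u = proj v"
  then have "snd u mod int t = snd v mod int t" using t by (simp add: proj_def nat_eq_iff2)
  then have "cyc_dist t (snd u mod int t) (snd v mod int t) = 0" by (simp only: cyc_dist_self)
  then have "cyc_dist t (snd u) (snd v) = 0" by simp
  then show False using cyc_dist_close[OF assms(2)] assms(1) eq by (auto simp: proj_def prod_eq_iff)
qed

lemma no_between:
  assumes "u \<in> P" "v \<in> P" "z \<in> P" "u \<noteq> v" "u \<noteq> z" "v \<noteq> z"
    "2 * \<bar>snd u - snd v\<bar> \<le> int t" "2 * \<bar>snd u - snd z\<bar> \<le> int t" "2 * \<bar>snd z - snd v\<bar> \<le> int t"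
  shows "max (d (fst u) (fst v)) \<bar>snd u - snd v\<bar> \<noteq>
    max (d (fst u) (fst z)) \<bar>snd u - snd z\<bar> + max (d (fst z) (fst v)) \<bar>snd z - snd v\<bar>"
proof -
  have "proj u \<noteq> proj v" "proj u \<noteq> proj z" "proj v \<noteq> proj z"
    using proj_neq[OF assms(4,7)] proj_neq[OF assms(5,8)] proj_neq[of z v] assms(6,9) by auto
  then have "torus_dist s t (proj u) (proj v) \<noteq> torus_dist s t (proj u) (proj z) + torus_dist s t (proj z) (proj v)"
    using between_freeD[OF bf] assms(1-3) by (simp add: P_def)
  then show ?thesis using cyc_dist_close assms(7-9) by (simp add: torus_dist_proj)
qed

lemma flat_fst: "flat_set d P Q \<Longrightarrow> u \<in> Q \<Longrightarrow> fst u < s"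
  using fst_P unfolding flat_set_def by blast

text \<open>
  Two points of an antichain are further apart in the first cycle than in the second, so the first cycle alone
  determines their distance in the product.
\<close>

lemma flat_pair:
  assumes Q: "flat_set d P Q" and uv: "u \<in> Q" "v \<in> Q" "u \<noteq> v"
  shows "\<bar>snd u - snd v\<bar> < d (fst u) (fst v)" "fst u \<noteq> fst v" "2 * \<bar>snd u - snd v\<bar> \<le> int t"
proof -
  have P: "fst u < s" "fst v < s" using flat_fst[OF Q] uv(1,2) by blast+
  have ns: "\<not> steep d u v" "\<not> steep d v u" using Q uv by (auto simp: flat_set_def)
  have pos: "d (fst u) (fst v) > 0" if "snd u = snd v"
    using uv(3) that cyc_dist_eq_0[OF P] cyc_dist_nonneg[of s "int (fst u)" "int (fst v)"] P
    by (auto simp: prod_eq_iff order_less_le)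
  show lt: "\<bar>snd u - snd v\<bar> < d (fst u) (fst v)"
    using ns pos by (auto simp: steep_def cyc_dist_sym[of s "int (fst v)"] abs_if)
  then show "fst u \<noteq> fst v" by (auto simp: cyc_dist_def)
  have "int (s div 2) \<le> int (t div 2) + 1" using st by linarith
  then have "int s div 2 \<le> int t div 2 + 1" by (simp add: of_nat_div)
  moreover have "d (fst u) (fst v) \<le> int s div 2"
    using cyc_dist_le_half[OF P] zdiv_mono1[of "2 * d (fst u) (fst v)" "int s" 2] by simp
  ultimately have "\<bar>snd u - snd v\<bar> \<le> h" using lt by linarith
  then have "2 * \<bar>snd u - snd v\<bar> \<le> 2 * h" by simp
  also have "2 * h \<le> int t" by simp
  finally show "2 * \<bar>snd u - snd v\<bar> \<le> int t" .
qed

lemma flat_projection: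
  assumes Q: "flat_set d P Q"
  shows "inj_on fst Q" "fst ` Q \<subseteq> {..<s}" "between_free d (fst ` Q)"
proof -
  show "inj_on fst Q" using flat_pair(2)[OF Q] by (meson inj_onI)
  show "fst ` Q \<subseteq> {..<s}" using flat_fst[OF Q] by (simp add: image_subset_iff)
  show "between_free d (fst ` Q)"
    unfolding between_free_def
  proof (intro ballI impI)
    fix x y z assume "x \<in> fst ` Q" "y \<in> fst ` Q" "z \<in> fst ` Q" and ne: "x \<noteq> y" "x \<noteq> z" "y \<noteq> z"
    then obtain u v r where q: "u \<in> Q" "v \<in> Q" "r \<in> Q" "fst u = x" "fst v = y" "fst r = z" by blast
    then have ne': "u \<noteq> v" "u \<noteq> r" "r \<noteq> v" using ne by auto
    have QP: "u \<in> P" "v \<in> P" "r \<in> P" using Q q by (auto simp: flat_set_def)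
    show "d x y \<noteq> d x z + d z y"
      using no_between[OF QP ne'(1,2) ne'(3)[symmetric]] flat_pair(1,3)[OF Q q(1,2) ne'(1)]
        flat_pair(1,3)[OF Q q(1,3) ne'(2)] flat_pair(1,3)[OF Q q(3,2) ne'(3)] q(4-6) by simp
  qed
qed

lemma flat_width: "flat_set d P Q \<Longrightarrow> finite Q \<and> card Q \<le> w"
proof -
  assume Q: "flat_set d P Q"
  note fp = flat_projection[OF Q]
  have "finite Q" using fp(1,2) by (metis finite_imageD finite_lessThan finite_subset)
  moreover have "card (fst ` Q) \<le> w"
    using cycle_between_free_card_le_3[OF fp(2,3)] cycle_4_between_free_card_le_2 fp(2,3)
    by (auto simp: cycle_gp_def)
  ultimately show ?thesis using card_image[OF fp(1)] by simp
qed

sublocale band P d "int t" h w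
proof
  show "d x x = 0" for x by (simp add: cyc_dist_def)
  show "d x z \<le> d x y + d y z" for x y z using s by (intro cyc_dist_triangle) auto
  show "(x, k + i * int t) \<in> P" if "(x, k) \<in> P" for x k i using that by (simp add: P_def proj_def)
  show "int t = 2 * h \<or> int t = 2 * h + 1" by presburger
  show "1 \<le> h" using t by simp
  show "h < snd r - snd u" if "u \<in> P" "v \<in> P" "r \<in> P" "steep d u v" "steep d v r" for u v r
  proof (rule ccontr)
    assume short: "\<not> ?thesis"
    have st: "snd u < snd v" "d (fst u) (fst v) \<le> snd v - snd u" "snd v < snd r" "d (fst v) (fst r) \<le> snd r - snd v"
      using that by (auto simp: steep_def)
    have "d (fst u) (fst r) \<le> d (fst u) (fst v) + d (fst v) (fst r)" using s by (intro cyc_dist_triangle) auto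
    then have dur: "d (fst u) (fst r) \<le> snd r - snd u" using st by linarith
    have ne: "u \<noteq> r" "u \<noteq> v" "r \<noteq> v" using st by auto
    have "2 * (snd r - snd u) \<le> 2 * h" using short by simp
    also have "2 * h \<le> int t" by simp
    finally have short': "2 * (snd r - snd u) \<le> int t" .
    have close: "2 * \<bar>snd u - snd r\<bar> \<le> int t" "2 * \<bar>snd u - snd v\<bar> \<le> int t" "2 * \<bar>snd v - snd r\<bar> \<le> int t"
      using short' st(1,3) by (simp_all add: abs_if)
    show False using no_between[OF that(1,3,2) ne close] st dur by simp
  qed
  show "finite Q \<and> card Q \<le> w" if "flat_set d P Q" for Q using flat_width[OF that] .
qed

lemma card_period: "card {p \<in> P. 0 \<le> snd p \<and> snd p < int t} = card S"
proof -
  have "{p \<in> P. 0 \<le> snd p \<and> snd p < int t} = (\<lambda>p. (fst p, int (snd p))) ` S"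
  proof (intro equalityI subsetI)
    fix p assume "p \<in> {p \<in> P. 0 \<le> snd p \<and> snd p < int t}"
    then have "proj p \<in> S" "p = (fst (proj p), int (snd (proj p)))" by (auto simp: P_def proj_def prod_eq_iff)
    then show "p \<in> (\<lambda>p. (fst p, int (snd p))) ` S" by blast
  next
    fix p assume "p \<in> (\<lambda>p. (fst p, int (snd p))) ` S"
    then show "p \<in> {p \<in> P. 0 \<le> snd p \<and> snd p < int t}" using S by (auto simp: P_def proj_def)
  qed
  then show ?thesis by (simp add: card_image inj_on_def prod_eq_iff)
qed

text \<open>
  Levels in an antichain differ by less than the distance of the columns. This distance is at most
  \<open>2\<close> if \<open>s \<le> 5\<close>; for \<open>s = 6\<close> it could be \<open>3\<close> for two
  points, but not for two members of an antichain of three.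
\<close>

lemma wide_flat_span:
  assumes Q: "flat_set d P Q" "card Q = w" "u \<in> Q" "v \<in> Q"
  shows "snd u \<le> snd v + 1"
proof (cases "u = v")
  case False
  have "d (fst u) (fst v) \<le> 2"
  proof (cases "s = 6")
    case True
    then have "card (Q - {u, v}) = 1" using Q flat_width[OF Q(1)] False by (simp add: cycle_gp_def)
    then obtain z where "Q - {u, v} = {z}" by (metis card_1_singletonE)
    then have z: "z \<in> Q" "z \<noteq> u" "z \<noteq> v" by blast+
    note fp = flat_projection[OF Q(1)]
    have "d (fst u) (fst v) = 2"
      unfolding True
    proof (rule cycle_6_triple[where c = "fst z"])
      show "between_free (cycle_metric 6) {fst u, fst v, fst z}"
        using fp(3) Q(3,4) z(1) True by (auto intro: between_free_subset)
    qed (use fp(2) flat_pair(2)[OF Q(1)] Q(3,4) z False True in auto)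
    then show ?thesis by simp
  next
    case False
    have "fst u < s" "fst v < s" using flat_fst[OF Q(1)] Q(3,4) by blast+
    then show ?thesis using cyc_dist_le_half[of "fst u" s "fst v"] s False by auto
  qed
  then show ?thesis using flat_pair(1)[OF Q(1,3,4) False] by linarith
qed simp

lemma wide_flat_column:
  assumes a: "flat_set d P (insert a M)" "card (insert a M) = w" "a \<notin> M"
    and b: "flat_set d P (insert b M)" "card (insert b M) = w" "b \<notin> M"
    and M: "\<And>m. m \<in> M \<Longrightarrow> snd m = snd a + 1" and ab: "snd b = snd a + 2"
  shows "fst a = fst b"
proof -
  have fin: "finite M" using flat_width[OF a(1)] by simp
  then have cM: "card M = w - 1" using a(2,3) by simp
  have lt: "fst a < s" "fst b < s" "\<And>m. m \<in> M \<Longrightarrow> fst m < s"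
    using flat_fst[OF a(1)] flat_fst[OF b(1)] by blast+
  have far: "d (fst a) (fst m) > 1" "d (fst b) (fst m) > 1" if "m \<in> M" for m
  proof -
    have "a \<noteq> m" "b \<noteq> m" using that a(3) b(3) by auto
    then show "d (fst a) (fst m) > 1" "d (fst b) (fst m) > 1"
      using flat_pair(1)[OF a(1), of a m] flat_pair(1)[OF b(1), of b m] M[OF that] ab that by auto
  qed
  have "M \<noteq> {}" using cM by (auto simp: cycle_gp_def split: if_splits)
  then obtain m where m: "m \<in> M" by blast
  show ?thesis
  proof (cases "s = 4")
    case True
    then show ?thesis using cycle_4_far_unique[of "fst a" "fst b" "fst m"] lt m far[OF m] by simp
  next
    case False
    then have "card (M - {m}) = 1" using cM m fin by (simp add: cycle_gp_def)
    then obtain k where "M - {m} = {k}" by (metis card_1_singletonE)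
    then have k: "k \<in> M" "m \<noteq> k" by auto
    have mk: "fst m \<noteq> fst k" using flat_pair(2)[OF a(1), of m k] k m by simp
    have "s \<noteq> 3" using cyc_dist_le_half[OF lt(1) lt(3)[OF m]] far(1)[OF m] by auto
    then consider "s = 5" | "s = 6" using s False by auto
    then show ?thesis
    proof cases
      case 1
      then show ?thesis
        using cycle_5_far_unique[of "fst a" "fst b" "fst m" "fst k"] lt m k mk far[OF m] far[OF k(1)] by simp
    next
      case 2
      have tri: "cycle_metric 6 (fst x) (fst y) = 2"
        if "flat_set d P (insert c M)" "c \<notin> M" "{x, y, z} = {c, m, k}" "x \<noteq> y" "x \<noteq> z" "y \<noteq> z" for c x y z
      proof (rule cycle_6_triple[where c = "fst z"])
        have xyz: "x \<in> insert c M" "y \<in> insert c M" "z \<in> insert c M"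
          using that(3) m k(1) by blast+
        show "fst x < 6" "fst y < 6" "fst z < 6" using flat_projection(2)[OF that(1)] xyz 2 by auto
        show "fst x \<noteq> fst y" "fst x \<noteq> fst z" "fst y \<noteq> fst z" using flat_pair(2)[OF that(1)] xyz that(4-6) by auto
        show "between_free (cycle_metric 6) {fst x, fst y, fst z}"
          using flat_projection(3)[OF that(1)] xyz 2 by (auto intro: between_free_subset)
      qed
      have ne: "a \<noteq> m" "a \<noteq> k" "b \<noteq> m" "b \<noteq> k" using a(3) b(3) m k(1) by auto
      show ?thesis
      proof (rule cycle_6_triple_unique[of _ _ "fst m" "fst k"])
        show "cycle_metric 6 (fst m) (fst k) = 2" by (rule tri[OF a(1,3), of m k a]) (use ne k in auto)
        show "cycle_metric 6 (fst a) (fst m) = 2" by (rule tri[OF a(1,3), of a m k]) (use ne k in auto)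
        show "cycle_metric 6 (fst b) (fst m) = 2" by (rule tri[OF b(1,3), of b m k]) (use ne k in auto)
        show "cycle_metric 6 (fst a) (fst k) = 2" by (rule tri[OF a(1,3), of a k m]) (use ne k in auto)
        show "cycle_metric 6 (fst b) (fst k) = 2" by (rule tri[OF b(1,3), of b k m]) (use ne k in auto)
      qed (use lt m k 2 in auto)
    qed
  qed
qed

lemma crowded_bandI: "card S = 3 * w + 1 \<Longrightarrow> crowded_band P d (int t) h w"
  by unfold_locales
    (use wide_flat_span wide_flat_column card_period in \<open>auto simp: cycle_gp_def\<close>)

end

section \<open>The upper bound\<close>

lemma cycle_5_off_pair:
  assumes "a < 5" "m < 5" "k < 5" "x < 5" "m \<noteq> k" "x \<noteq> a" "x \<noteq> m" "x \<noteq> k"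
    "cycle_metric 5 a m = 2" "cycle_metric 5 a k = 2"
  shows "cycle_metric 5 a x = 1 \<and> (cycle_metric 5 x m = 1 \<or> cycle_metric 5 x k = 1)"
  using assms(5-) less_5_cases[OF assms(1)] less_5_cases[OF assms(2)] less_5_cases[OF assms(3)] less_5_cases[OF assms(4)]
  by (elim disjE) (simp_all add: cyc_dist_def)

lemma cycle_5_pair:
  assumes "a < 5" "m < 5" "k < 5" "m \<noteq> k" "cycle_metric 5 a m = 2" "cycle_metric 5 a k = 2"
  shows "cycle_metric 5 m k = 1"
  using assms(4-) less_5_cases[OF assms(1)] less_5_cases[OF assms(2)] less_5_cases[OF assms(3)]
  by (elim disjE) (simp_all add: cyc_dist_def)

context torus_set
begin

text \<open>
  A period of five levels leaves \<open>s = 5\<close>: for \<open>s = 3\<close> an antichain stays on one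
  level. In $C_5$ the two points \<open>m\<close>, \<open>k\<close> of \<open>M\<close> occupy the two
  adjacent columns at distance two from those of \<open>a\<close> and \<open>b\<close>. A second point on the
  level of \<open>a\<close> is either next to \<open>a\<close> in its row, and then between \<open>a\<close>
  and a point of \<open>M\<close>, or in the column of \<open>m\<close> or \<open>k\<close>; likewise for
  \<open>b\<close>. So the further points \<open>u\<close> and \<open>v\<close> are both in these two columns,
  and the point of \<open>M\<close> in the column of \<open>v\<close> is between them.
\<close>

lemma card_neq:
  assumes "s = 4 \<longrightarrow> t \<noteq> 4" "s \<noteq> 4 \<longrightarrow> s \<le> t"
  shows "card S \<noteq> 3 * w + 1"
proof
  assume "card S = 3 * w + 1"
  then interpret crowded_band P d "int t" h w by (rule crowded_bandI)
  obtain a M b u v y where h: "h = 2" "w = 3" "int t = 5"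
    and aM: "one_lower a M y" and bM: "one_upper b M (y + 1)"
    and u: "u \<in> P" "u \<noteq> a" "snd u = y" and v: "v \<in> P" "v \<noteq> b" "snd v = y + 2"
    by (rule period_five) blast
  have A: "flat_set d P (insert a M)" "card (insert a M) = w" "a \<notin> M" "snd a = y" "\<And>m. m \<in> M \<Longrightarrow> snd m = y + 1"
    using aM by (simp_all add: one_lower_def staggered_def)
  have B: "flat_set d P (insert b M)" "b \<notin> M" "snd b = y + 2"
    using bM by (simp_all add: one_upper_def staggered_def)
  have "finite M" using A(1) width by (metis finite_insert)
  then have "card M = 2" using A(2,3) h(2) by simp
  then obtain m k where M: "M = {m, k}" "m \<noteq> k" by (auto simp: card_2_iff)
  have lt: "fst x < s" if "x \<in> {a, b, m, k}" for x
    using that flat_fst[OF A(1)] flat_fst[OF B(1)] M by blast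
  have far: "d (fst x) (fst z) > 1" if "x \<in> {a, b}" "z \<in> {m, k}" for x z
  proof -
    have "x \<noteq> z" using that A(3) B(2) M by auto
    then have "\<bar>snd x - snd z\<bar> < d (fst x) (fst z)"
      using flat_pair(1)[OF A(1), of x z] flat_pair(1)[OF B(1), of x z] that M by auto
    then show ?thesis using that A(4,5) B(3) M by auto
  qed
  have "s \<noteq> 3" using far[of a m] cyc_dist_le_half[OF lt[of a] lt[of m]] by auto
  then have s5: "s = 5" using s h(2,3) assms(2) by (auto simp: cycle_gp_def split: if_splits)
  have two: "cycle_metric 5 (fst x) (fst z) = 2" if "x \<in> {a, b}" "z \<in> {m, k}" for x z
    using far[OF that] cyc_dist_le_half[OF lt[of x] lt[of z]] that s5 by auto
  have mk: "fst m \<noteq> fst k" using flat_pair(2)[OF A(1), of m k] M by simp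
  have beside: "fst x = fst m \<or> fst x = fst k"
    if x: "x \<in> P" "x \<noteq> c" "snd x = snd c" and c: "c \<in> {a, b}" for x c
  proof (rule ccontr)
    assume neg: "\<not> ?thesis"
    have cP: "c \<in> P" "m \<in> P" "k \<in> P" using A(1) B(1) M c by (auto simp: flat_set_def)
    have "fst x \<noteq> fst c" using x by (auto simp: prod_eq_iff)
    then have *: "cycle_metric 5 (fst c) (fst x) = 1"
      "cycle_metric 5 (fst x) (fst m) = 1 \<or> cycle_metric 5 (fst x) (fst k) = 1"
      using cycle_5_off_pair[of "fst c" "fst m" "fst k" "fst x"] lt[of c] lt[of m] lt[of k] fst_P[OF x(1)]
        two[OF c] mk neg c s5 by auto
    then obtain z where z: "z \<in> {m, k}" "cycle_metric 5 (fst x) (fst z) = 1" by blast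
    have lev: "\<bar>snd c - snd z\<bar> = 1" using z(1) c A(4,5) B(3) M by auto
    have ne: "c \<noteq> z" "x \<noteq> z" using z(1) neg c A(3) B(2) M by auto
    have zP: "z \<in> P" using z(1) cP by blast
    show False
      using no_between[OF cP(1) zP x(1) ne(1) x(2)[symmetric] ne(2)[symmetric]] lev x(3) h(3)
        two[OF c z(1)] * z(2) s5 by simp
  qed
  have u': "fst u = fst m \<or> fst u = fst k" using beside[of u a] u A(4) by auto
  have v': "fst v = fst m \<or> fst v = fst k" using beside[of v b] v B(3) by auto
  then have "\<exists>z\<in>{m, k}. fst z = fst v" by auto
  then obtain z where z: "z \<in> {m, k}" "fst z = fst v" by blast
  have "cycle_metric 5 (fst m) (fst k) = 1"
    using cycle_5_pair[of "fst a" "fst m" "fst k"] lt[of a] lt[of m] lt[of k] two[of a] mk s5 by auto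
  then have "d (fst u) (fst v) \<le> 1"
    using u' v' s5 cyc_dist_sym[of 5 "int (fst m)" "int (fst k)"] by auto
  then have "steep d u z" "steep d z v"
    using z A(5) M u v by (auto simp: steep_def)
  moreover have "z \<in> P" using z(1) A(1) M by (auto simp: flat_set_def)
  ultimately show False using long_chain[OF u(1) _ v(1), of z] u(3) v(3) h(1) by simp
qed

text \<open>
  If a level were empty, the other three would have at most four points; so all levels are inhabited, and one
  of them contains two points \<open>q\<close>, \<open>q'\<close>. Three points on consecutive levels are in
  general position only if the middle one is antipodal, in the first coordinate, to one of its neighbours.
  Going around the four levels, with \<open>p\<close>, \<open>r\<close>, \<open>z\<close> on the others, this
  puts \<open>z\<close> into the column of \<open>q\<close> and into that of \<open>q'\<close>.
\<close>

lemma card_neq_4_4: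
  assumes st: "s = 4" "t = 4"
  shows "card S \<noteq> 5"
proof
  assume S5: "card S = 5"
  have h: "h = 2" and w: "w = 2" using st by (simp_all add: cycle_gp_def)
  have level: "\<exists>p\<in>P. snd p = y" for y
  proof (rule ccontr)
    assume neg: "\<not> ?thesis"
    define J where "J = {p \<in> P. y + 1 \<le> snd p \<and> snd p \<le> y + 1 + h}"
    have J: "finite J \<and> card J \<le> 2 * 2"
      by (rule window_card[where y = "y + 1"]) (use flat_width w in \<open>auto simp: J_def\<close>)
    have "card {p \<in> P. 0 \<le> snd p \<and> snd p < int t} \<le> card J"
    proof (rule card_transversal)
      show "finite J" using J by blast
      fix p assume p: "p \<in> P"
      define m where "m = - ((snd p - y) div 4)"
      have "snd p + m * 4 = y + (snd p - y) mod 4"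
        unfolding m_def by (simp add: minus_div_mult_eq_mod[symmetric])
      then have lev: "snd (shift m p) = y + (snd p - y) mod 4" unfolding snd_shift using st(2) by simp
      have mP: "shift m p \<in> P" using shift_in_P[OF p] .
      then have "snd (shift m p) \<noteq> y" using neg by blast
      moreover have "0 \<le> (snd p - y) mod 4" "(snd p - y) mod 4 < 4" by simp_all
      ultimately have "y + 1 \<le> snd (shift m p) \<and> snd (shift m p) \<le> y + 1 + h"
        using lev h by linarith
      then have "shift m p \<in> J" using mP unfolding J_def by blast
      then show "\<exists>m. shift m p \<in> J" by blast
    qed
    then show False using J S5 by (simp add: card_period)
  qed
  have far: "cycle_metric 4 (fst u) (fst v) > 1 \<or> cycle_metric 4 (fst v) (fst z) > 1"
    if "u \<in> P" "v \<in> P" "z \<in> P" "snd v = snd u + 1" "snd z = snd u + 2" for u v z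
  proof (rule ccontr)
    assume "\<not> ?thesis"
    then have "steep d u v" "steep d v z" using that st by (auto simp: steep_def)
    then show False using long_chain[OF that(1-3)] that(5) h by simp
  qed
  have "\<not> inj_on snd S"
  proof
    assume "inj_on snd S"
    then have "card S \<le> card {..<t}" by (rule card_inj_on_le) (use S in auto)
    then show False using S5 st by simp
  qed
  then obtain e e' where "e \<in> S" "e' \<in> S" "snd e = snd e'" "e \<noteq> e'" unfolding inj_on_def by blast
  then obtain x x' k where xx: "(x, k) \<in> S" "(x', k) \<in> S" "x \<noteq> x'" by (metis prod.collapse)
  define y where "y = int k"
  define q q' where "q = (x, y)" and "q' = (x', y)"
  have q: "q \<in> P" "q' \<in> P" "snd q = y" "snd q' = y" "fst q \<noteq> fst q'"
    using xx S by (auto simp: P_def proj_def q_def q'_def y_def)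
  obtain p r z where p: "p \<in> P" "snd p = y - 1" and r: "r \<in> P" "snd r = y + 1" and z: "z \<in> P" "snd z = y + 2"
    using level by metis
  have p4: "shift 1 p \<in> P" "snd (shift 1 p) = y + 3" "fst (shift 1 p) = fst p"
    unfolding snd_shift fst_shift using shift_in_P[OF p(1), of 1] p(2) st(2) by simp_all
  have shifted: "shift 1 c \<in> P" "snd (shift 1 c) = y + 4" "fst (shift 1 c) = fst c" if "c \<in> {q, q'}" for c
    unfolding snd_shift fst_shift using that q(1-4) shift_in_P[of c 1] st(2) by auto
  let ?far = "\<lambda>u v. cycle_metric 4 (fst u) (fst v) > 1"
  have uniq: "fst u = fst v" if "?far u c" "?far v c" "u \<in> P" "v \<in> P" "c \<in> P" for u v c
    using cycle_4_far_unique[of "fst u" "fst v" "fst c"] that fst_P st by simp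
  have sym: "?far u v \<longleftrightarrow> ?far v u" for u v by (simp add: cyc_dist_sym)
  have main: False
    if c: "c \<in> P" "c' \<in> P" "snd c = y" "snd c' = y" "fst c \<noteq> fst c'" "{c, c'} = {q, q'}"
      and pc: "?far p c" and rc: "?far c' r" for c c'
  proof -
    have cp: "?far c p" using pc sym by blast
    have cr: "\<not> ?far c r" using uniq[OF _ rc c(1,2) r(1)] c(5) by blast
    have "?far c r \<or> ?far r z" by (rule far[OF c(1) r(1) z(1)]) (use c(3) r z in simp_all)
    then have "?far z r" using cr sym[of r z] by blast
    then have z1: "fst z = fst c'" by (rule uniq[OF _ rc z(1) c(2) r(1)])
    have pc': "\<not> ?far p c'" using uniq[OF cp _ c(1,2) p(1)] sym[of p c'] c(5) by blast
    have c4: "shift 1 c' \<in> P" "snd (shift 1 c') = y + 4" "fst (shift 1 c') = fst c'"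
      using shifted[of c'] c(6) by blast+
    have "?far z (shift 1 p) \<or> ?far (shift 1 p) (shift 1 c')"
      by (rule far[OF z(1) p4(1) c4(1)]) (use z(2) p4(2) c4(2) in simp_all)
    then have "?far z p" using pc' unfolding p4(3) c4(3) by blast
    then have "fst z = fst c" by (rule uniq[OF _ cp z(1) c(1) p(1)])
    then show False using z1 c(5) by simp
  qed
  have "?far p q \<or> ?far q r" by (rule far[OF p(1) q(1) r(1)]) (use p q r in simp_all)
  moreover have "?far p q' \<or> ?far q' r" by (rule far[OF p(1) q(2) r(1)]) (use p q r in simp_all)
  moreover have "\<not> (?far p q \<and> ?far p q')"
    using uniq[OF _ _ q(1,2) p(1)] sym[of p q] sym[of p q'] q(5) by blast
  moreover have "\<not> (?far q r \<and> ?far q' r)" using uniq[OF _ _ q(1,2) r(1)] q(5) by blast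
  ultimately have "(?far p q \<and> ?far q' r) \<or> (?far p q' \<and> ?far q r)" by blast
  then show False
    using main[OF q(1,2,3,4,5)] main[OF q(2,1,4,3) q(5)[symmetric]] by (auto simp: insert_commute)
qed

end

lemma torus_dist_swap: "torus_dist t s (prod.swap u) (prod.swap v) = torus_dist s t u v"
  by (simp add: torus_dist_def max.commute)

lemma between_free_torus_swap:
  "between_free (torus_dist s t) S \<Longrightarrow> between_free (torus_dist t s) (prod.swap ` S)"
  by (simp add: between_free_def torus_dist_swap inj_eq[OF inj_swap])

text \<open>
  General position is hereditary, so it suffices to exclude sets with exactly one point too many.
\<close>

lemma torus_card_le:
  assumes s: "s \<in> {3, 4, 5, 6}" and t: "t \<ge> 3" and shape: "s = 4 \<longrightarrow> t \<noteq> 4" "s \<noteq> 4 \<longrightarrow> s \<le> t"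
    and S: "S \<subseteq> {..<s} \<times> {..<t}" "between_free (torus_dist s t) S"
  shows "card S \<le> 3 * cycle_gp s"
proof (rule ccontr)
  assume "\<not> ?thesis"
  then obtain T where T: "T \<subseteq> S" "card T = 3 * cycle_gp s + 1"
    by (metis Suc_eq_plus1 not_less_eq_eq obtain_subset_with_card_n)
  interpret torus_set s t T
  proof
    show "s div 2 \<le> t div 2 + 1"
      using s t shape(2) div_le_mono[of s t 2] by (cases "s = 4") auto
  qed (use s t S T between_free_subset in auto)
  show False using card_neq[OF shape] T(2) by simp
qed

lemma torus_card_le_4_4:
  assumes S: "S \<subseteq> {..<4} \<times> {..<4}" "between_free (torus_dist 4 4) S"
  shows "card S \<le> 4"
proof (rule ccontr)
  assume "\<not> ?thesis"
  then obtain T where T: "T \<subseteq> S" "card T = 5"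
    using obtain_subset_with_card_n[of 5 S] by auto
  interpret torus_set 4 4 T by unfold_locales (use S T between_free_subset in auto)
  show False using card_neq_4_4 T(2) by simp
qed

section \<open>The lower bound and the general position number\<close>

lemma cycle_gp_attained:
  assumes "n \<ge> 3"
  shows "\<exists>X. X \<subseteq> {..<n} \<and> card X = cycle_gp n \<and> between_free (cycle_metric n) X"
proof (cases "n = 4")
  case True
  have "{0, 1} \<subseteq> {..<n} \<and> card {0, 1 :: nat} = cycle_gp n \<and> between_free (cycle_metric n) {0, 1}"
    using True by (auto simp: cycle_gp_def between_free_def)
  then show ?thesis by blast
next
  case False
  \<comment> \<open>The arcs between the three points have lengths $k$, $k$ and $n - 2k \in \{1, 2\}$, so each is a shortest path and none is as long as the other two together. The bound $n - 2k \le k$ behind this fails for $n = 4$.\<close>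
  define k where "k = (n - 1) div 2"
  have k: "k \<ge> 1" "2 * k < n" "n \<le> 2 * k + 2" "n \<le> 3 * k"
    using assms False unfolding k_def by presburger+
  have "cycle_metric n 0 k = int k" "cycle_metric n k (2 * k) = int k" "cycle_metric n 0 (2 * k) = int n - 2 * int k"
    using k by (subst cyc_dist_eq_abs; simp)+
  then have "between_free (cycle_metric n) {0, k, 2 * k}"
    using k cyc_dist_sym[of n "int k" 0] cyc_dist_sym[of n "2 * int k" 0] cyc_dist_sym[of n "2 * int k" "int k"]
    by (auto simp: between_free_def)
  moreover have "card {0, k, 2 * k} = cycle_gp n" using k(1) False by (simp add: cycle_gp_def)
  ultimately show ?thesis using k by (intro exI[of _ "{0, k, 2 * k}"]) auto
qed

text \<open>
  In a coordinate that realises the distance of \<open>u\<close> and \<open>v\<close>, the triangle inequality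
  forces the other two distances to be realised as well; being positive, they make the three coordinates
  distinct.
\<close>

lemma between_free_Times:
  assumes st: "s > 0" "t > 0" and XY: "X \<subseteq> {..<s}" "Y \<subseteq> {..<t}"
    and X: "between_free (cycle_metric s) X" and Y: "between_free (cycle_metric t) Y"
  shows "between_free (torus_dist s t) (X \<times> Y)"
proof -
  have key: False
    if bf: "between_free (cycle_metric n) Z" and Z: "Z \<subseteq> {..<n}" "a \<in> Z" "b \<in> Z" "c \<in> Z"
      and D: "D = cycle_metric n a b" "D = D1 + D2" "cycle_metric n a c \<le> D1" "cycle_metric n c b \<le> D2" "D1 > 0" "D2 > 0"
    for n Z a b c D D1 D2
  proof -
    have n: "n > 0" using Z by auto
    have eq: "cycle_metric n a c = D1" "cycle_metric n c b = D2"
      using cyc_dist_triangle[OF n, of "int a" "int b" "int c"] D by linarith+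
    have "a \<noteq> c" "c \<noteq> b" "a \<noteq> b" using eq D by auto
    then show False using between_freeD[OF bf Z(2,3,4)] eq D by auto
  qed
  show ?thesis
    unfolding between_free_def
  proof (intro ballI impI)
    fix u v z assume uvz: "u \<in> X \<times> Y" "v \<in> X \<times> Y" "z \<in> X \<times> Y" and ne: "u \<noteq> v" "u \<noteq> z" "v \<noteq> z"
    have pos: "torus_dist s t p q > 0" if pq: "p \<in> X \<times> Y" "q \<in> X \<times> Y" "p \<noteq> q" for p q
    proof -
      have lt: "fst p < s" "fst q < s" "snd p < t" "snd q < t" using pq XY by auto
      have "cycle_metric s (fst p) (fst q) \<noteq> 0 \<or> cycle_metric t (snd p) (snd q) \<noteq> 0"
        using cyc_dist_eq_0[OF lt(1,2)] cyc_dist_eq_0[OF lt(3,4)] pq(3) by (auto simp: prod_eq_iff)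
      then show ?thesis
        using cyc_dist_nonneg[OF st(1), of "int (fst p)" "int (fst q)"] cyc_dist_nonneg[OF st(2), of "int (snd p)" "int (snd q)"]
        by (auto simp: torus_dist_def)
    qed
    show "torus_dist s t u v \<noteq> torus_dist s t u z + torus_dist s t z v"
    proof
      assume eq: "torus_dist s t u v = torus_dist s t u z + torus_dist s t z v"
      have p: "torus_dist s t u z > 0" "torus_dist s t z v > 0" using pos uvz ne by auto
      consider "torus_dist s t u v = cycle_metric s (fst u) (fst v)" | "torus_dist s t u v = cycle_metric t (snd u) (snd v)"
        unfolding torus_dist_def by linarith
      then show False
      proof cases
        case 1
        show False by (rule key[OF X XY(1) _ _ _ 1 eq _ _ p, of "fst z"]) (use uvz in \<open>auto simp: torus_dist_def\<close>)
      next
        case 2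
        show False by (rule key[OF Y XY(2) _ _ _ 2 eq _ _ p, of "snd z"]) (use uvz in \<open>auto simp: torus_dist_def\<close>)
      qed
    qed
  qed
qed

lemma gp_eqI:
  assumes "finite (pverts G)" "general_position_set G S" "card S = n"
    and "\<And>T. general_position_set G T \<Longrightarrow> card T \<le> n"
  shows "gp G = n"
proof -
  have "{S. general_position_set G S} \<subseteq> Pow (pverts G)" by (auto simp: general_position_set_def)
  then have "finite {S. general_position_set G S}" using assms(1) finite_subset by blast
  then show ?thesis unfolding gp_def using assms(2-4) by (intro Max_eqI) auto
qed

lemma gp_cycles_eqI:
  assumes st: "s \<ge> 3" "t \<ge> 3"
    and upper: "\<And>S. S \<subseteq> {..<s} \<times> {..<t} \<Longrightarrow> between_free (torus_dist s t) S \<Longrightarrow> card S \<le> cycle_gp s * cycle_gp t"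
  shows "gp (cycle_graph s \<boxtimes> cycle_graph t) = cycle_gp s * cycle_gp t"
proof -
  obtain X where X: "X \<subseteq> {..<s}" "card X = cycle_gp s" "between_free (cycle_metric s) X"
    using cycle_gp_attained[OF st(1)] by blast
  obtain Y where Y: "Y \<subseteq> {..<t}" "card Y = cycle_gp t" "between_free (cycle_metric t) Y"
    using cycle_gp_attained[OF st(2)] by blast
  show ?thesis
  proof (rule gp_eqI)
    show "finite (pverts (cycle_graph s \<boxtimes> cycle_graph t))" by (simp add: pverts_cycles)
    show "card (X \<times> Y) = cycle_gp s * cycle_gp t" using X Y by (simp add: card_cartesian_product)
    show "general_position_set (cycle_graph s \<boxtimes> cycle_graph t) (X \<times> Y)"
      unfolding general_position_set_cycles[OF st]
      using between_free_Times[OF _ _ X(1) Y(1) X(3) Y(3)] X(1) Y(1) st by auto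
    show "card T \<le> cycle_gp s * cycle_gp t" if "general_position_set (cycle_graph s \<boxtimes> cycle_graph t) T" for T
      using that upper unfolding general_position_set_cycles[OF st] by blast
  qed
qed

lemma torus_card_le_swap:
  assumes le: "\<And>S. S \<subseteq> {..<t} \<times> {..<s} \<Longrightarrow> between_free (torus_dist t s) S \<Longrightarrow> card S \<le> n"
    and S: "S \<subseteq> {..<s} \<times> {..<t}" "between_free (torus_dist s t) S"
  shows "card S \<le> n"
proof -
  have "prod.swap ` S \<subseteq> {..<t} \<times> {..<s}" using S(1) by auto
  then have "card (prod.swap ` S) \<le> n" using le between_free_torus_swap[OF S(2)] by blast
  then show ?thesis by (simp add: card_image)
qed

text \<open>
  A cycle of length four, if there is one, is taken as the first factor; otherwise the shorter cycle is.
\<close>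

lemma torus_card_le_product:
  assumes st: "s \<ge> 3" "t \<ge> 3" "min s t \<le> 6" and S: "S \<subseteq> {..<s} \<times> {..<t}" "between_free (torus_dist s t) S"
  shows "card S \<le> cycle_gp s * cycle_gp t"
proof -
  have small: "n \<in> {3, 4, 5, 6}" if "n \<ge> 3" "n \<le> 6" for n :: nat using that by auto
  consider "s = 4" "t = 4" | "s = 4" "t \<noteq> 4" | "t = 4" "s \<noteq> 4" | "s \<noteq> 4" "t \<noteq> 4" "s \<le> t" | "s \<noteq> 4" "t \<noteq> 4" "t \<le> s"
    by linarith
  then show ?thesis
  proof cases
    case 1
    then show ?thesis using torus_card_le_4_4 S by (simp add: cycle_gp_def)
  next
    case 2
    then show ?thesis using torus_card_le[of s t S] st S by (simp add: cycle_gp_def)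
  next
    case 3
    then show ?thesis
      using torus_card_le_swap[OF torus_card_le[of t s] S] st by (simp add: cycle_gp_def)
  next
    case 4
    then show ?thesis using torus_card_le[of s t S] small[of s] st S by (simp add: cycle_gp_def)
  next
    case 5
    then show ?thesis
      using torus_card_le_swap[OF torus_card_le[of t s] S] small[of t] st by (simp add: cycle_gp_def)
  qed
qed

theorem proposition4p3:
  fixes s t :: nat
  assumes "s \<ge> 3" and "t \<ge> 3" and "min s t \<le> 6"
  shows "gp (cycle_graph s \<boxtimes> cycle_graph t) =
    (if s = 4 \<and> t = 4 then 4
     else if s = 4 \<or> t = 4 then 6
     else 9)"
  using gp_cycles_eqI[OF assms(1,2)] torus_card_le_product[OF assms]
  by (simp add: cycle_gp_def)

end
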